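(* Let $m,n\in\mathbb{Z}$ with $m+n\ge 1$ and $n\le -1$, and let $\mu,\nu$ be the (nonnegative) integers determined by the parity cases below. Then: - if $m=2\mu+2\nu$, $n=-2\nu$: $\mathfrak{S}(q_{m,n}) = (p_-\,z_-\,z_+\,p_+)^{\mu}\,(p_-\,z_-)^{\nu-1}\,p_- \,\hat{z}_-\,p_-\,(z_-\,p_-)^{\nu-1}\,(p_+\,z_+\,z_-\,p_-)^{\mu}$; - if $m=2+2\mu+2\nu$, $n=-1-2\nu$: $\mathfrak{S}(q_{m,n}) = (p_-\,z_-\,z_+\,p_+)^{\mu}\,p_-\,z_-\,(z_+\,p_+)^{\nu}\,z_+\,\hat{p}_+\, z_+\,(p_+\,z_+)^{\nu}\,z_-\,p_-\,(p_+\,z_+\,z_-\,p_-)^{\mu}$; - if $m=1+2\mu+2\nu$, $n=-2\nu$: $\mathfrak{S}(q_{m,n}) = (p_-\,z_-\,z_+\,p_+)^{\mu+1}\,(z_+\,p_+)^{\nu-1}\,\hat{z}_+\,(p_+\,z_+)^{\nu-1}\,(p_+\,z_+\,z_-\,p_-)^{\mu+1}$; - if $m=1+2\mu+2\nu$, $n=-1-2\nu$: $\mathfrak{S}(q_{m,n}) = (p_-\,z_-\,z_+\,p_+)^{\mu}\,(p_-\,z_-)^{\nu}\,\hat{p}_-\,(z_-\,p_-)^{\nu}\,(p_+\,z_+\,z_-\,p_-)^{\mu}$.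
   Context: For real parameters $a=(a_0,a_1,a_2)$ with $a_0+a_1+a_2=1$, $a_1\neq 0$, the fourth Painlevé equation $P_{IV}$ is $q''=\frac{(q')^2}{2q}+\frac32 q^3+4tq^2+2(t^2+a_2-a_0)q-\frac{2a_1^2}{q}$. Poles of a solution are simple with residue $\pm1$: residue $+1$ is a plus pole ($p_+$), residue $-1$ a minus pole ($p_-$). Zeros are simple with $q(t)=2\epsilon a_1(t-t_* )+O((t-t_* )^2)$, $\epsilon\in\{\pm1\}$: $\epsilon=+1$ a plus zero ($z_+$), $\epsilon=-1$ a minus zero ($z_-$). The generalised Okamoto polynomials $Q_{m,n}(t)$ are defined by $Q_{m,n-1}Q_{m,n+1}=\frac92(Q_{m,n}''Q_{m,n}-(Q_{m,n}')^2)+(2t^2+3(m+2n+1))Q_{m,n}^2$, $Q_{m+1,n}Q_{m-1,n}=\frac92(Q_{m,n}''Q_{m,n}-(Q_{m,n}')^2)+(2t^2+3(-2m+n-1))Q_{m,n}^2$, with $Q_{0,0}=Q_{-1,0}=Q_{0,-1}=1$, $Q_{-1,-1}=\sqrt2\,t$. The generalised Okamoto rational $q_{m,n}=-\frac23 t+\frac{d}{dt}\log\frac{Q_{m-1,n}}{Q_{m,n}}$ solves $P_{IV}$ with $a=(\frac13-m-n,\frac13+n,\frac13+m)$. For a real solution $q$ with real zeros/poles $t_1<\dots<t_N$, the singularity signature $\mathfrak{S}(q)$ is the word $s_1\cdots s_N$, $s_i\in\{z_+,z_-,p_+,p_-\}$ the type at $t_i$; $(w)^k$ is $k$-fold repetition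 ($(w)^0$ empty), and $\hat s$ marks the letter at $t=0$.
   Formalization: The second recurrence for Q_{m,n} is taken with constant 3(-2m-n-1) instead of 3(-2m+n-1); with the latter and the given seeds no polynomial family exists, since at (0,-1) it forces Q_{1,-1} = (2t^2-6)/(sqrt2 t). *)

theory Defs
  imports Complex_Main "HOL-Computational_Algebra.Polynomial"
begin

definition okamoto_rec :: "(int \<Rightarrow> int \<Rightarrow> real poly) \<Rightarrow> bool" where
  "okamoto_rec Q \<longleftrightarrow>
     Q 0 0 = 1 \<and> Q (-1) 0 = 1 \<and> Q 0 (-1) = 1 \<and> Q (-1) (-1) = [:0, sqrt 2:] \<and>
     (\<forall>m n. Q m (n - 1) * Q m (n + 1) =
        smult (9/2) (pderiv (pderiv (Q m n)) * Q m n - (pderiv (Q m n))^2)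
        + [:3 * of_int (m + 2*n + 1), 0, 2:] * (Q m n)^2) \<and>
     (\<forall>m n. Q (m + 1) n * Q (m - 1) n =
        smult (9/2) (pderiv (pderiv (Q m n)) * Q m n - (pderiv (Q m n))^2)
        + [:3 * of_int (-2*m - n - 1), 0, 2:] * (Q m n)^2)"

definition okamoto_Q :: "int \<Rightarrow> int \<Rightarrow> real poly" where
  "okamoto_Q = (THE Q. okamoto_rec Q)"

(* q_{m,n} = -2/3 t + d/dt log (Q_{m-1,n} / Q_{m,n}), written out *)
definition okamoto_q :: "int \<Rightarrow> int \<Rightarrow> real \<Rightarrow> real" where
  "okamoto_q m n t =
     - (2/3) * t
     + poly (pderiv (okamoto_Q (m - 1) n)) t / poly (okamoto_Q (m - 1) n) t
     - poly (pderiv (okamoto_Q m n)) t / poly (okamoto_Q m n) t"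

datatype sing = Zp | Zm | Pp | Pm

definition is_pole :: "(real \<Rightarrow> real) \<Rightarrow> real \<Rightarrow> bool" where
  "is_pole q t \<longleftrightarrow> filterlim (\<lambda>s. \<bar>q s\<bar>) at_top (at t)"

definition is_zero :: "(real \<Rightarrow> real) \<Rightarrow> real \<Rightarrow> bool" where
  "is_zero q t \<longleftrightarrow> isCont q t \<and> q t = 0"

(* type of a zero/pole of a P_IV solution with parameter a_1 *)
definition sing_type :: "real \<Rightarrow> (real \<Rightarrow> real) \<Rightarrow> real \<Rightarrow> sing \<Rightarrow> bool" where
  "sing_type a1 q t s \<longleftrightarrow> (case s of
       Pp \<Rightarrow> ((\<lambda>x. (x - t) * q x) \<longlongrightarrow> 1) (at t)
     | Pm \<Rightarrow> ((\<lambda>x. (x - t) * q x) \<longlongrightarrow> -1) (at t)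
     | Zp \<Rightarrow> q t = 0 \<and> (q has_real_derivative (2 * a1)) (at t)
     | Zm \<Rightarrow> q t = 0 \<and> (q has_real_derivative (- 2 * a1)) (at t))"

definition pw :: "nat \<Rightarrow> sing list \<Rightarrow> sing list" where
  "pw k w = concat (replicate k w)"

(* signature of q is L @ [s] @ R, with the letter s (the hatted one) located at t = 0 *)
definition has_signature ::
    "real \<Rightarrow> (real \<Rightarrow> real) \<Rightarrow> sing list \<Rightarrow> sing \<Rightarrow> sing list \<Rightarrow> bool" where
  "has_signature a1 q L s R \<longleftrightarrow>
     (\<exists>ts :: real list.
        sorted_wrt (<) ts \<and>
        set ts = {t. is_zero q t \<or> is_pole q t} \<and>
        length ts = length (L @ s # R) \<and>
        (\<forall>i < length ts. sing_type a1 q (ts ! i) ((L @ s # R) ! i)) \<and>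
        ts ! length L = 0)"

end

theory Submission
  imports Defs "HOL-Computational_Algebra.Polynomial_Factorial" "HOL-Computational_Algebra.Field_as_Ring"
begin

text \<open>
  The polynomials sit on a triangular lattice. For a lattice triangle with entries \<open>x, y, z\<close> the functions
  \<open>f\<^sub>0 = 2t/3 + (ln (z/y))'\<close>, \<open>f\<^sub>1 = 2t/3 + (ln (x/z))'\<close>, \<open>f\<^sub>2 = 2t/3 + (ln (y/x))'\<close> solve the symmetric form of
  \<open>P\<^sub>I\<^sub>V\<close>, and reflecting a vertex in the opposite edge is a Baecklund transformation. If \<open>s\<close> is the
  reflection of \<open>x\<close>, then \<open>x s\<close> is a multiple of \<open>f\<^sub>0 y z\<close>, and the Wronskian of \<open>x\<close> and \<open>s\<close> is a
  multiple of \<open>y z\<close>; this makes \<open>x y z s\<close> squarefree and gives the Toda equations.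
  Since every real root of \<open>x y z s\<close> is simple, the sign of the derivative alternates along the roots; the
  bilinear relations determine this sign from the factor that vanishes. Hence the order of the roots of
  \<open>x, y, z\<close> determines where the roots of \<open>s\<close> lie, and the order of the roots can be followed
  combinatorially from the triangle \<open>1, 1, 1\<close> through the whole sector. Finally \<open>q\<^sub>m\<^sub>,\<^sub>n = - f\<close> for an edge, with zeros and
  poles at the roots of the four polynomials of the rhombus around that edge.
\<close>

section \<open>Reflection of triangles\<close>

abbreviation tX :: "real poly" where "tX \<equiv> [:0, 1:]"
abbreviation root2 :: "real poly" where "root2 \<equiv> [:sqrt 2:]"

text \<open>Up to the factor \<open>3 a b\<close>, this is \<open>2t/3 + (ln (a/b))'\<close>.\<close>

definition bilin :: "real poly \<Rightarrow> real poly \<Rightarrow> real poly" where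
  "bilin a b = 2 * tX * a * b + 3 * (pderiv a * b - a * pderiv b)"

definition toda :: "int \<Rightarrow> real poly \<Rightarrow> real poly" where
  "toda j z = 9 * (z * pderiv (pderiv z) - pderiv z ^ 2) + (4 * tX^2 + 6 * of_int j) * z^2"

text \<open>The three equations are \<open>f\<^sub>i f\<^sub>i\<^sub>+\<^sub>1 = (ln \<tau>)'' + 4t\<^sup>2/9 + const\<close>; their differences are the symmetric form of \<open>P\<^sub>I\<^sub>V\<close>
  with \<open>3a\<^sub>0 = j - k + 1\<close> and cyclically \<open>3a\<^sub>1 = k - i + 1\<close>, \<open>3a\<^sub>2 = i - j + 1\<close>.\<close>

definition triple :: "real poly \<Rightarrow> real poly \<Rightarrow> real poly \<Rightarrow> int \<Rightarrow> int \<Rightarrow> int \<Rightarrow> bool" where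
  "triple x y z i j k \<longleftrightarrow>
     bilin z y * bilin x z = x * y * toda k z \<and>
     bilin x z * bilin y x = y * z * toda i x \<and>
     bilin y x * bilin z y = z * x * toda j y \<and>
     coprime x y \<and> coprime y z \<and> coprime z x \<and>
     coprime x (pderiv x) \<and> coprime y (pderiv y) \<and> coprime z (pderiv z)"

text \<open>The constant \<open>root2\<close> is forced by \<open>Q\<^sub>-\<^sub>1\<^sub>,\<^sub>-\<^sub>1 = sqrt 2 t\<close>; the integer \<open>a\<close> is \<open>3a\<^sub>0\<close>.\<close>

definition mirror :: "real poly \<Rightarrow> real poly \<Rightarrow> real poly \<Rightarrow> real poly \<Rightarrow> int \<Rightarrow> bool" where
  "mirror x y z s a \<longleftrightarrow> root2 * x * s = bilin z y \<and>
     root2 * (x * pderiv s - s * pderiv x) = 2 * of_int a * y * z"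

lemma root2_square: "root2 * root2 = 2"
  by (simp add: numeral_poly)

lemma pderiv_const_polys:
  "pderiv (numeral k :: real poly) = 0" "pderiv (of_int l :: real poly) = 0" "pderiv root2 = 0" "pderiv tX = 1"
  by (simp_all add: numeral_poly of_int_poly pderiv_pCons)

lemmas pderiv_expand = pderiv_add pderiv_diff pderiv_mult pderiv_const_polys mult_zero_left mult_zero_right add_0_left add_0_right

lemma pderiv_bilin:
  "pderiv (bilin a b) = 2 * a * b + 2 * tX * (pderiv a * b + a * pderiv b)
     + 3 * (pderiv (pderiv a) * b - a * pderiv (pderiv b))"
  unfolding bilin_def by (simp only: pderiv_expand algebra_simps mult_1_right)

lemma triple_rotate: "triple x y z i j k \<Longrightarrow> triple y z x j k i"
  unfolding triple_def by (simp add: mult_ac)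

lemma coprime_pderiv_nonzero: "coprime x (pderiv x) \<Longrightarrow> x \<noteq> (0 :: real poly)"
  by auto

lemma triple_nonzero:
  assumes "triple x y z i j k"
  shows "x \<noteq> 0" "y \<noteq> 0" "z \<noteq> 0"
  using assms coprime_pderiv_nonzero unfolding triple_def by blast+

text \<open>This is \<open>f\<^sub>0' = f\<^sub>0 (f\<^sub>1 - f\<^sub>2) + 2a\<^sub>0\<close>,
  cleared of denominators. It is the difference of the two equations that contain
  \<open>bilin z y\<close>.\<close>

lemma triple_deriv:
  assumes "triple x y z i j k"
  shows "pderiv (bilin z y) * x - 2 * bilin z y * pderiv x = 2 * of_int (j - k + 1) * x * y * z"
proof -
  define T where "T = tX"
  define x1 y1 z1 x2 y2 z2 where d: "x1 = pderiv x" "y1 = pderiv y" "z1 = pderiv z"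
    "x2 = pderiv x1" "y2 = pderiv y1" "z2 = pderiv z1"
  define F where "F = bilin z y"
  have F: "F = 2 * T * z * y + 3 * (z1 * y - z * y1)" by (simp only: F_def bilin_def d T_def)
  have F1: "pderiv F = 2 * z * y + 2 * T * (z1 * y + z * y1) + 3 * (z2 * y - z * y2)"
    unfolding F_def pderiv_bilin d T_def ..
  have h1: "F * bilin x z = x * y * toda k z" and h2: "bilin y x * F = z * x * toda j y"
    using assms unfolding triple_def F_def by auto
  have key: "bilin y x * z - bilin x z * y = 3 * (x * (y1 * z + y * z1) - 2 * x1 * y * z)"
    unfolding bilin_def d by algebra
  \<comment> \<open>The second derivatives in the two Toda expressions cancel against those in
    \<open>pderiv F\<close>.\<close>
  have br: "3 * (pderiv F * y * z - F * (y1 * z + y * z1)) + (z^2 * toda j y - y^2 * toda k z)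
      = 6 * of_int (j - k + 1) * y^2 * z^2"
    unfolding F1 unfolding F toda_def d[symmetric] T_def[symmetric] of_int_add of_int_diff of_int_1 by algebra
  have "F * (bilin y x * z - bilin x z * y) = x * (z^2 * toda j y - y^2 * toda k z)"
    using h1 h2 by algebra
  then have "3 * y * z * (pderiv F * x - 2 * F * x1) = 3 * y * z * (2 * of_int (j - k + 1) * x * y * z)"
    using br unfolding key by algebra
  moreover have "3 * y * z \<noteq> 0" using triple_nonzero[OF assms] by simp
  ultimately show ?thesis unfolding F_def d by (metis mult_left_cancel)
qed

text \<open>Modulo \<open>x\<close>, \<open>triple_deriv\<close> leaves twice
  \<open>bilin z y * pderiv x\<close>, and \<open>x\<close> is coprime to its derivative; so
  \<open>x\<close> divides \<open>bilin z y\<close>. The Wronskian relation is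
  \<open>triple_deriv\<close> again, divided by \<open>x\<close>.\<close>

lemma mirror_exists:
  assumes "triple x y z i j k"
  obtains s where "mirror x y z s (j - k + 1)"
proof -
  have "x dvd bilin z y * pderiv x"
  proof -
    have "2 * (bilin z y * pderiv x) = x * (pderiv (bilin z y) - 2 * of_int (j - k + 1) * y * z)"
      using triple_deriv[OF assms] by algebra
    then have "x dvd 2 * (bilin z y * pderiv x)" by (metis dvd_triv_left)
    moreover have "2 * (bilin z y * pderiv x) = smult 2 (bilin z y * pderiv x)" by (simp add: numeral_poly)
    ultimately show ?thesis by (metis dvd_smult_cancel zero_neq_numeral)
  qed
  moreover have "coprime x (pderiv x)" using assms by (simp add: triple_def)
  ultimately have "x dvd bilin z y" by (simp add: coprime_dvd_mult_left_iff)
  then obtain c where c: "bilin z y = x * c" by (elim dvdE)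
  define s where "s = smult (1 / sqrt 2) c"
  have rs: "root2 * s = c" by (simp add: s_def)
  have F: "root2 * x * s = bilin z y" using c rs by (metis mult.assoc mult.commute)
  define r where "r = root2"
  have "pderiv (bilin z y) = r * (pderiv x * s + x * pderiv s)"
    unfolding F[symmetric] r_def by (simp only: pderiv_expand algebra_simps)
  moreover have "bilin z y = r * x * s" using F r_def by simp
  ultimately have "x * (r * (x * pderiv s - s * pderiv x)) = x * (2 * of_int (j - k + 1) * y * z)"
    using triple_deriv[OF assms] by algebra
  then have "r * (x * pderiv s - s * pderiv x) = 2 * of_int (j - k + 1) * y * z"
    using triple_nonzero[OF assms] by simp
  then have "mirror x y z s (j - k + 1)" using F by (simp only: mirror_def r_def)
  then show ?thesis by (rule that)
qed

lemma is_unit_numeral_poly: "is_unit (numeral k :: real poly)"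
proof -
  have "numeral k * [:1 / numeral k:] = (1 :: real poly)" by (simp add: numeral_poly one_pCons)
  then show ?thesis by (metis dvd_triv_left)
qed

text \<open>Modulo \<open>y\<close> only \<open>- 3 * z * pderiv y\<close> survives.\<close>

lemma coprime_bilin:
  assumes "coprime z y" "coprime y (pderiv y)"
  shows "coprime y (bilin z y)"
proof -
  have e: "bilin z y = y * (2 * tX * z + 3 * pderiv z) + (- 3) * (z * pderiv y)"
    unfolding bilin_def by algebra
  have "coprime y ((- 3) * (z * pderiv y))"
  proof -
    have "is_unit (- 3 :: real poly)"
      by (metis is_unit_numeral_poly minus_dvd_iff)
    then show ?thesis using assms by (simp add: coprime_commute is_unit_right_imp_coprime)
  qed
  then show ?thesis unfolding e
    by (metis coprime_iff_gcd_eq_1 gcd_add_mult mult.commute add.commute)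
qed


text \<open>A common divisor of \<open>s\<close> and its derivative divides the Wronskian, hence
  \<open>y * z\<close>; as \<open>s\<close> is coprime to \<open>y\<close> and \<open>z\<close>, it
  is a unit.\<close>

lemma mirror_coprime:
  assumes "triple x y z i j k" "mirror x y z s a" "a \<noteq> 0"
  shows "coprime s y" "coprime z s" "coprime s (pderiv s)"
proof -
  have t: "coprime x y" "coprime y z" "coprime z x" "coprime y (pderiv y)" "coprime z (pderiv z)"
    using assms(1) by (auto simp: triple_def)
  have F: "root2 * x * s = bilin z y" and W: "root2 * (x * pderiv s - s * pderiv x) = 2 * of_int a * y * z"
    using assms(2) by (auto simp: mirror_def)
  have "coprime y (root2 * x * s)" unfolding F using coprime_bilin t by (simp add: coprime_commute)
  then show sy: "coprime s y" by (simp only: coprime_mult_right_iff coprime_commute)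
  \<comment> \<open>The same reduction modulo \<open>z\<close>, where
    \<open>3 * y * pderiv z\<close> survives.\<close>
  have e: "z * (2 * tX * y - 3 * pderiv y) + 3 * (y * pderiv z) = bilin z y"
    unfolding bilin_def by algebra
  have "is_unit (3 :: real poly)"
    by (rule is_unit_numeral_poly)
  then have "coprime z (3 * (y * pderiv z))"
    using t by (simp add: coprime_commute is_unit_right_imp_coprime)
  then have "coprime z (root2 * x * s)" unfolding F e[symmetric]
    by (metis coprime_iff_gcd_eq_1 gcd_add_mult mult.commute add.commute)
  then show zs: "coprime z s" by (simp only: coprime_mult_right_iff)
  show "coprime s (pderiv s)"
  proof (rule coprimeI)
    fix d assume d: "d dvd s" "d dvd pderiv s"
    then have "d dvd root2 * (x * pderiv s - s * pderiv x)"
      by (intro dvd_mult dvd_diff dvd_mult2)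
    then have "d dvd (2 * of_int a) * (y * z)" unfolding W by (simp only: mult.assoc)
    moreover have "(2 * of_int a :: real poly) = [:2 * of_int a:]" by (simp add: numeral_poly of_int_poly)
    ultimately have "d dvd y * z" using assms(3) by (simp add: dvd_smult_iff)
    moreover have "coprime s (y * z)" using sy zs by (simp add: coprime_commute)
    ultimately show "is_unit d" using d(1) coprime_common_divisor by blast
  qed
qed

text \<open>The parameters \<open>a\<^sub>0, a\<^sub>1, a\<^sub>2\<close> become
  \<open>- a\<^sub>0, a\<^sub>1 + a\<^sub>0, a\<^sub>2 + a\<^sub>0\<close>. Two equations follow
  from the old ones through the Wronskian; the third also needs the derivative of the Wronskian
  relation.\<close>

lemma mirror_triple:
  assumes t: "triple x y z i j k" and m: "mirror x y z s a" and a: "a = j - k + 1" "a \<noteq> 0"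
  shows "triple s y z i (j - a) (k + a)"
proof -
  define T r where "T = tX" "r = root2"
  have rr: "r * r = 2" unfolding T_r_def by (rule root2_square)
  define A :: "real poly" where "A = of_int a"
  define x1 y1 z1 s1 where d: "x1 = pderiv x" "y1 = pderiv y" "z1 = pderiv z" "s1 = pderiv s"
  define x2 s2 where d2: "x2 = pderiv (pderiv x)" "s2 = pderiv (pderiv s)"
  note nz = triple_nonzero[OF t]
  have F: "r * x * s = bilin z y" and W: "r * (x * s1 - s * x1) = 2 * A * y * z"
    using m by (auto simp: mirror_def T_r_def A_def d)
  have H2: "bilin z y * bilin x z = x * y * toda k z" and H0: "bilin x z * bilin y x = y * z * toda i x"
    and H1: "bilin y x * bilin z y = z * x * toda j y"
    using t unfolding triple_def by auto
  have rnz: "r \<noteq> 0" by (simp add: T_r_def)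
  have T2: "toda (k + a) z = toda k z + 6 * A * z^2"
    unfolding toda_def A_def of_int_add by algebra
  have T1: "toda (j - a) y = toda j y - 6 * A * y^2"
    unfolding toda_def A_def of_int_diff by algebra
  \<comment> \<open>Exchanging \<open>x\<close> for \<open>s\<close> in a bilinear expression costs
    a Wronskian, which is known to be a multiple of \<open>y * z\<close>.\<close>
  have K: "x * bilin s z - s * bilin x z = 3 * z * (x * s1 - s * x1)"
    unfolding bilin_def d by algebra
  have G: "x * bilin y s - s * bilin y x = - 3 * y * (x * s1 - s * x1)"
    unfolding bilin_def d by algebra
  have "x * (bilin z y * bilin s z) = x * (s * y * toda (k + a) z)"
    using K W F H2 rr unfolding T2 by algebra
  then have N2: "bilin z y * bilin s z = s * y * toda (k + a) z" using nz by simp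
  have "x * (bilin y s * bilin z y) = x * (z * s * toda (j - a) y)"
    using G W F H1 rr unfolding T1 by algebra
  then have N1: "bilin y s * bilin z y = z * s * toda (j - a) y" using nz by simp
  have dW: "r * (x * s2 - s * x2) = 2 * A * (y1 * z + y * z1)"
  proof -
    have "pderiv (r * (x * s1 - s * x1)) = r * (x * s2 - s * x2)"
      unfolding T_r_def d d2 by (simp only: pderiv_expand) algebra
    moreover have "pderiv (2 * A * y * z) = 2 * A * (y1 * z + y * z1)"
      unfolding A_def d by (simp only: pderiv_expand) algebra
    ultimately show ?thesis using W by simp
  qed
  have key: "bilin y x * z - bilin x z * y = 3 * (x * (y1 * z + y * z1) - 2 * x1 * y * z)"
    unfolding bilin_def d by algebra
  define w where "w = x * s1 - s * x1"
  define w1 where "w1 = x * s2 - s * x2"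
  have w: "r * w = 2 * A * y * z" and w1: "r * w1 = 2 * A * (y1 * z + y * z1)"
    using W dW by (simp_all add: w_def w1_def)
  have e0: "x^2 * toda i s - s^2 * toda i x = 9 * (s * x * w1 - w * (s * x1 + x * s1))"
    unfolding toda_def w_def w1_def d d2 by algebra
  have K': "x * bilin s z = s * bilin x z + 3 * z * w" and G': "x * bilin y s = s * bilin y x - 3 * y * w"
    using K G unfolding w_def by algebra+
  have "x^2 * (bilin s z * bilin y s) = (x * bilin s z) * (x * bilin y s)" by algebra
  also have "\<dots> = s^2 * (y * z * toda i x) + 3 * w * s * (bilin y x * z - bilin x z * y) - 9 * y * z * w^2"
    unfolding K' G' using H0 by algebra
  also have "\<dots> = s^2 * (y * z * toda i x) + 9 * w * s * (x * (y1 * z + y * z1) - 2 * x1 * y * z) - 9 * y * z * w^2"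
    unfolding key by algebra
  finally have e1: "x^2 * (bilin s z * bilin y s) = s^2 * (y * z * toda i x)
     + 9 * w * s * (x * (y1 * z + y * z1) - 2 * x1 * y * z) - 9 * y * z * w^2" .
  \<comment> \<open>\<open>w\<close>, whose derivative is \<open>w1\<close>, is a constant multiple
    of \<open>y * z\<close>, so the Wronskian of the two vanishes.\<close>
  have e2: "w * (y1 * z + y * z1) = w1 * y * z"
  proof -
    have "r * (w * (y1 * z + y * z1)) = r * (w1 * y * z)" using w w1 by algebra
    then show ?thesis using rnz by simp
  qed
  have "x^2 * (bilin s z * bilin y s) = x^2 * (y * z * toda i s)"
    using e0 e1 e2 w_def by algebra
  then have N0: "bilin s z * bilin y s = y * z * toda i s" using nz by simp
  show ?thesis
    using N0 N1 N2 t mirror_coprime[OF t m a(2)] by (simp add: triple_def)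
qed

lemma mirror_sym: "mirror x y z s a \<Longrightarrow> mirror s y z x (- a)"
  unfolding mirror_def by (simp add: algebra_simps)

lemma mirror_exists_index:
  assumes "triple x y z i j k" "j - k + 1 = a"
  shows "\<exists>s. mirror x y z s a"
  using mirror_exists assms by blast

lemma mirror_triple_index:
  assumes "triple x y z i j k" "mirror x y z s a" "j - k + 1 = a" "a \<noteq> 0"
    "i' = i" "j' = j - a" "k' = k + a"
  shows "triple s y z i' j' k'"
  using mirror_triple assms by blast

text \<open>Reflecting \<open>x\<close> and then \<open>y\<close> leads half way round the vertex
  \<open>z\<close>, so \<open>u\<close> lies opposite to \<open>x\<close>. The product
  \<open>x * u\<close> depends only on \<open>z\<close> and its index.\<close>

lemma toda_cw:
  assumes t: "triple x y z i j k" and m: "mirror x y z s a" "mirror y z s u b"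
    and a: "j - k + 1 = a" "a \<noteq> 0" "c = k + a"
  shows "2 * x * u = toda c z"
proof -
  have t': "triple s y z i (j - a) c" using mirror_triple_index[OF t m(1)] a by simp
  have "bilin z y * bilin s z = s * y * toda c z" using t' by (simp add: triple_def)
  moreover have "root2 * x * s = bilin z y" "root2 * y * u = bilin s z" using m by (simp_all add: mirror_def)
  ultimately have "(root2 * x * s) * (root2 * y * u) = s * y * toda c z" by simp
  then have "(s * y) * (2 * x * u) = (s * y) * toda c z"
    using root2_square by algebra
  then show ?thesis using triple_nonzero[OF t'] by simp
qed

lemma toda_ccw:
  assumes t: "triple x y z i j k" and m: "mirror x y z s a" "mirror z s y u b"
    and a: "j - k + 1 = a" "a \<noteq> 0" "c = j - a"
  shows "2 * x * u = toda c y"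
proof -
  have t': "triple s y z i c (k + a)" using mirror_triple_index[OF t m(1)] a by simp
  have "bilin y s * bilin z y = z * s * toda c y" using t' by (simp add: triple_def)
  moreover have "root2 * x * s = bilin z y" "root2 * z * u = bilin y s" using m by (simp_all add: mirror_def)
  ultimately have "(root2 * z * u) * (root2 * x * s) = z * s * toda c y" by simp
  then have "(s * z) * (2 * x * u) = (s * z) * toda c y"
    using root2_square by algebra
  then show ?thesis using triple_nonzero[OF t'] by simp
qed

lemma double_mult_cancel:
  assumes "2 * x * u = t" "2 * x * v = t" "x \<noteq> (0 :: real poly)"
  shows "u = v"
  using assms by (metis mult_cancel_left no_zero_divisors zero_neq_numeral)

section \<open>The lattice of Okamoto polynomials\<close>

text \<open>Dependent choice in both directions from 0. It builds first one strip, moving along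
  \<open>m\<close>, and then the whole lattice, moving along \<open>n\<close>.\<close>

lemma int_chain:
  fixes P :: "int \<Rightarrow> 'a \<Rightarrow> bool"
  assumes base: "P 0 a"
    and up: "\<And>m x. P m x \<Longrightarrow> \<exists>y. P (m + 1) y \<and> R m x y"
    and down: "\<And>m y. P (m + 1) y \<Longrightarrow> \<exists>x. P m x \<and> R m x y"
  shows "\<exists>f. f 0 = a \<and> (\<forall>m. P m (f m) \<and> R m (f m) (f (m + 1)))"
proof -
  \<comment> \<open>The clause for \<open>i = 0\<close> pins the start, which dependent choice alone
    leaves free.\<close>
  have "\<exists>g. \<forall>i. (P (int i) (g i) \<and> (i = 0 \<longrightarrow> g i = a)) \<and> R (int i) (g i) (g (Suc i))"
  proof (rule dependent_nat_choice)
    show "\<exists>x. P (int 0) x \<and> (0 = (0::nat) \<longrightarrow> x = a)" using base by simp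
    show "\<exists>y. (P (int (Suc i)) y \<and> (Suc i = 0 \<longrightarrow> y = a)) \<and> R (int i) x y"
      if "P (int i) x \<and> (i = 0 \<longrightarrow> x = a)" for x i
      using up[of "int i" x] that by (simp add: add.commute)
  qed
  then obtain g where g: "\<And>i. P (int i) (g i)" "g 0 = a" "\<And>i. R (int i) (g i) (g (Suc i))"
    by auto
  have "\<exists>x. P (- int (Suc i)) x \<and> R (- int (Suc i)) x y" if "P (- int i) y" for i y
    using down[of "- int (Suc i)" y] that by simp
  then have "\<exists>h. \<forall>i. (P (- int i) (h i) \<and> (i = 0 \<longrightarrow> h i = a)) \<and> R (- int (Suc i)) (h (Suc i)) (h i)"
    by (intro dependent_nat_choice) (use base in auto)
  then obtain h where h: "\<And>i. P (- int i) (h i)" "h 0 = a" "\<And>i. R (- int (Suc i)) (h (Suc i)) (h i)"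
    by auto
  define f where "f m = (if m \<ge> 0 then g (nat m) else h (nat (- m)))" for m
  have "P m (f m) \<and> R m (f m) (f (m + 1))" for m
  proof (cases "m \<ge> 0")
    case True
    then show ?thesis using g(1,3)[of "nat m"] by (simp add: f_def nat_add_distrib)
  next
    case False
    define i where "i = nat (- m - 1)"
    have m: "m = - int (Suc i)" using False by (simp add: i_def)
    have "f m = h (Suc i)" "f (m + 1) = h i"
      using g(2) h(2) unfolding f_def m by (auto simp: nat_add_distrib nat_diff_distrib)
    then show ?thesis using h(1)[of "Suc i"] h(3)[of i] m by simp
  qed
  then show ?thesis using g(2) by (intro exI[of _ f]) (auto simp: f_def)
qed

text \<open>\<open>A\<close> and \<open>B\<close> are the rows \<open>n\<close> and \<open>n - 1\<close>. The last two clauses are the two kinds of reflection that stay inside the strip.\<close>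

definition strip :: "int \<Rightarrow> (int \<Rightarrow> real poly) \<Rightarrow> (int \<Rightarrow> real poly) \<Rightarrow> bool" where
  "strip n A B \<longleftrightarrow> (\<forall>m.
     triple (A m) (B m) (A (m - 1)) (m - n) (- 2 * m - n) (m + 2 * n) \<and>
     mirror (A m) (B m) (A (m - 1)) (B (m - 1)) (1 - 3 * m - 3 * n) \<and>
     mirror (A (m - 1)) (A m) (B m) (B (m + 1)) (1 + 3 * m))"

lemma triple_index_cong:
  "triple x y z i j k \<Longrightarrow> i = i' \<Longrightarrow> j = j' \<Longrightarrow> k = k' \<Longrightarrow> triple x y z i' j' k'"
  by simp

text \<open>These are reflection parameters in the lattice. None is divisible by 3, so no reflection
  degenerates.\<close>

lemma int_neq_0:
  "1 + 3 * i \<noteq> (0 :: int)" "- 1 - 3 * i \<noteq> (0 :: int)" "3 * i + 3 * j + 2 \<noteq> (0 :: int)"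
  "2 - 3 * i \<noteq> (0 :: int)" "1 - 3 * i - 3 * j \<noteq> (0 :: int)" "3 * i - 2 \<noteq> (0 :: int)"
  by presburger+

lemma strip_facts:
  assumes "strip n A B"
  shows "triple (A m) (B m) (A (m - 1)) (m - n) (- 2 * m - n) (m + 2 * n)"
    "mirror (A m) (B m) (A (m - 1)) (B (m - 1)) (1 - 3 * m - 3 * n)"
    "mirror (A (m - 1)) (A m) (B m) (B (m + 1)) (1 + 3 * m)"
    "triple (B (m - 1)) (B m) (A (m - 1)) (m - n) (m + 2 * n - 1) (1 - 2 * m - n)"
proof -
  show 1: "triple (A m) (B m) (A (m - 1)) (m - n) (- 2 * m - n) (m + 2 * n)"
    and 2: "mirror (A m) (B m) (A (m - 1)) (B (m - 1)) (1 - 3 * m - 3 * n)"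
    and 3: "mirror (A (m - 1)) (A m) (B m) (B (m + 1)) (1 + 3 * m)"
    using assms by (simp_all add: strip_def)
  show "triple (B (m - 1)) (B m) (A (m - 1)) (m - n) (m + 2 * n - 1) (1 - 2 * m - n)"
    by (rule mirror_triple_index[OF 1 2 _ int_neq_0(5)]) simp_all
qed

text \<open>Two reflections around a lattice vertex, in either direction, lead to the same value because both products are
  the Toda expression of that vertex. This is the braid relation that makes the next row well defined.\<close>

lemma strip_up:
  assumes st: "strip n A B"
  shows "\<exists>C. strip (n + 1) C A \<and> (\<forall>m. mirror (B (m + 1)) (A m) (A (m + 1)) (C m) (1 + 3 * n))"
proof -
  note up = strip_facts(1)[OF st]
  note m0 = strip_facts(2)[OF st]
  note m2 = strip_facts(3)[OF st]
  have lo: "triple (B m) (B (m + 1)) (A m) (m + 1 - n) (m + 2 * n) (- 1 - 2 * m - n)" for m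
    using strip_facts(4)[OF st, of "m + 1"] by (simp add: algebra_simps)
  have up': "triple (B (m + 1)) (A m) (A (m + 1)) (- 2 * m - 2 - n) (m + 1 + 2 * n) (m + 1 - n)" for m
    by (rule triple_index_cong[OF triple_rotate[OF up[of "m + 1", simplified]]]) simp_all
  have "\<exists>s. mirror (B (m + 1)) (A m) (A (m + 1)) s (1 + 3 * n)" for m
    by (rule mirror_exists_index[OF up']) simp
  then obtain C where C: "\<And>m. mirror (B (m + 1)) (A m) (A (m + 1)) (C m) (1 + 3 * n)"
    by metis
  have C': "mirror (B m) (A (m - 1)) (A m) (C (m - 1)) (1 + 3 * n)" for m
    using C[of "m - 1"] by simp
  have lo1: "triple (C m) (A m) (A (m + 1)) (- 2 * m - 2 - n) (m - n) (m + 2 + 2 * n)" for m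
    by (rule mirror_triple_index[OF up' C _ int_neq_0(1)]) simp_all
  note lo2 = triple_rotate[OF triple_rotate[OF lo1]]
  have E: "mirror (A (m + 1)) (C m) (A m) (C (m - 1)) (- 1 - 3 * m)" for m
  proof -
    obtain E where E: "mirror (A (m + 1)) (C m) (A m) E (- 1 - 3 * m)"
      using mirror_exists_index[OF lo2[of m], of "- 1 - 3 * m"] by auto
    have 1: "2 * B (m + 1) * E = toda (m - n) (A m)"
      by (rule toda_ccw[OF up' C E _ int_neq_0(1)]) simp_all
    have lo': "triple (B (m + 1)) (A m) (B m) (m + 2 * n) (- 1 - 2 * m - n) (m + 1 - n)"
      by (rule triple_rotate[OF lo])
    have m2': "mirror (B (m + 1)) (A m) (B m) (A (m - 1)) (- 1 - 3 * m)"
      using mirror_sym[OF m2[of m]] by simp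
    \<comment> \<open>Round \<open>A m\<close> the other way: through \<open>A (m - 1)\<close>
      instead of \<open>C m\<close>.\<close>
    have 2: "2 * B (m + 1) * C (m - 1) = toda (m - n) (A m)"
      by (rule toda_ccw[OF lo' m2' C' _ int_neq_0(2)]) simp_all
    show ?thesis using E double_mult_cancel[OF 1 2] triple_nonzero[OF lo'] by simp
  qed
  have E': "mirror (A (m - 1)) (A m) (C (m - 1)) (C m) (3 * m + 3 * n + 2)" for m
  proof -
    have t: "triple (A (m - 1)) (A m) (C (m - 1)) (m - 1 - n) (m + 1 + 2 * n) (- 2 * m - n)"
      using triple_rotate[OF lo1[of "m - 1"]] by (simp add: algebra_simps)
    obtain E where E: "mirror (A (m - 1)) (A m) (C (m - 1)) E (3 * m + 3 * n + 2)"
      using mirror_exists_index[OF t, of "3 * m + 3 * n + 2"] by auto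
    have u: "triple (B m) (A (m - 1)) (A m) (- 2 * m - n) (m + 2 * n) (m - n)"
      by (rule triple_rotate[OF up])
    have 1: "2 * B m * E = toda (m + 2 * n + 1) (A m)"
      by (rule toda_cw[OF u C' E _ int_neq_0(1)]) simp_all
    have m0': "mirror (B m) (B (m + 1)) (A m) (A (m + 1)) (3 * m + 3 * n + 2)"
      using mirror_sym[OF m0[of "m + 1"]] by (simp add: algebra_simps)
    have 2: "2 * B m * C m = toda (m + 2 * n + 1) (A m)"
      by (rule toda_cw[OF lo m0' C _ int_neq_0(3)]) simp_all
    show ?thesis using E double_mult_cancel[OF 1 2] triple_nonzero[OF u] by simp
  qed
  have "strip (n + 1) C A"
    unfolding strip_def
  proof (intro allI conjI)
    fix m
    have "triple (C (m - 1)) (C m) (A m) (m + 2 * n + 2) (m - n - 1) (- 2 * m - n - 1)"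
      by (rule mirror_triple_index[OF lo2[of m] E[of m] _ int_neq_0(2)]) simp_all
    from triple_rotate[OF this]
    show "triple (C m) (A m) (C (m - 1)) (m - (n + 1)) (- 2 * m - (n + 1)) (m + 2 * (n + 1))"
      by (simp add: algebra_simps)
    show "mirror (C m) (A m) (C (m - 1)) (A (m - 1)) (1 - 3 * m - 3 * (n + 1))"
      using mirror_sym[OF E'[of m]] by (simp add: algebra_simps)
    show "mirror (C (m - 1)) (C m) (A m) (A (m + 1)) (1 + 3 * m)"
      using mirror_sym[OF E[of m]] by (simp add: algebra_simps)
  qed
  then show ?thesis using C by blast
qed

text \<open>The argument of \<open>strip_up\<close> with the outer rows exchanged; it continues the
  lattice to negative \<open>n\<close>.\<close>

lemma strip_down:
  assumes st: "strip (n + 1) A B"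
  shows "\<exists>C. strip n B C \<and> (\<forall>m. mirror (C (m + 1)) (B m) (B (m + 1)) (A m) (1 + 3 * n))"
proof -
  note up = strip_facts(1)[OF st]
  note m0 = strip_facts(2)[OF st]
  note m2 = strip_facts(3)[OF st]
  note lo = strip_facts(4)[OF st]
  note lo' = triple_rotate[OF triple_rotate[OF lo]]
  have "\<exists>s. mirror (A (m - 1)) (B (m - 1)) (B m) s (- 1 - 3 * n)" for m
    by (rule mirror_exists_index[OF lo']) simp
  then obtain C where C: "\<And>m. mirror (A (m - 1)) (B (m - 1)) (B m) (C m) (- 1 - 3 * n)"
    by metis
  have C1: "mirror (A (m - 2)) (B (m - 2)) (B (m - 1)) (C (m - 1)) (- 1 - 3 * n)" for m
    using C[of "m - 1"] by simp
  have C2: "mirror (A m) (B m) (B (m + 1)) (C (m + 1)) (- 1 - 3 * n)" for m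
    using C[of "m + 1"] by simp
  have t: "triple (C m) (B (m - 1)) (B m) (- 2 * m - n) (m + 2 * n) (m - n)" for m
    by (rule mirror_triple_index[OF lo' C _ int_neq_0(2)]) simp_all
  note t1 = triple_rotate[OF t] and t2 = triple_rotate[OF triple_rotate[OF t]]
  have E: "mirror (B m) (C m) (B (m - 1)) (C (m - 1)) (1 - 3 * m - 3 * n)" for m
  proof -
    obtain E where E: "mirror (B m) (C m) (B (m - 1)) E (1 - 3 * m - 3 * n)"
      using mirror_exists_index[OF t2[of m], of "1 - 3 * m - 3 * n"] by auto
    have 1: "2 * A (m - 1) * E = toda (m + 2 * n) (B (m - 1))"
      by (rule toda_ccw[OF lo' C E _ int_neq_0(2)]) simp_all
    have u: "triple (A (m - 1)) (B (m - 1)) (A (m - 2)) (m - 2 - n) (1 - 2 * m - n) (m + 1 + 2 * n)"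
      using up[of "m - 1"] by (simp add: algebra_simps)
    have v: "mirror (A (m - 1)) (B (m - 1)) (A (m - 2)) (B (m - 2)) (1 - 3 * m - 3 * n)"
      using m0[of "m - 1"] by (simp add: algebra_simps)
    have 2: "2 * A (m - 1) * C (m - 1) = toda (m + 2 * n) (B (m - 1))"
      by (rule toda_ccw[OF u v C1 _ int_neq_0(5)]) simp_all
    show ?thesis using E double_mult_cancel[OF 1 2] triple_nonzero[OF u] by simp
  qed
  have E': "mirror (B (m - 1)) (B m) (C m) (C (m + 1)) (1 + 3 * m)" for m
  proof -
    obtain E where E: "mirror (B (m - 1)) (B m) (C m) E (1 + 3 * m)"
      using mirror_exists_index[OF t1[of m], of "1 + 3 * m"] by auto
    have 1: "2 * A (m - 1) * E = toda (m - n) (B m)"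
      by (rule toda_cw[OF lo' C E _ int_neq_0(2)]) simp_all
    note u = triple_rotate[OF triple_rotate[OF up[of m]]]
    have 2: "2 * A (m - 1) * C (m + 1) = toda (m - n) (B m)"
      by (rule toda_cw[OF u m2 C2 _ int_neq_0(1)]) simp_all
    show ?thesis using E double_mult_cancel[OF 1 2] triple_nonzero[OF u] by simp
  qed
  have "strip n B C"
    unfolding strip_def
  proof (intro allI conjI)
    fix m
    show "triple (B m) (C m) (B (m - 1)) (m - n) (- 2 * m - n) (m + 2 * n)"
      by (rule t2)
  qed (use E E' in auto)
  moreover have "mirror (C (m + 1)) (B m) (B (m + 1)) (A m) (1 + 3 * n)" for m
    using mirror_sym[OF C2[of m]] by (simp add: add.commute)
  ultimately show ?thesis by blast
qed

text \<open>A strip holds the triangles between two adjacent rows. The last clause is the third kind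
  of reflection, which leads from one strip into the next.\<close>

definition okamoto_lattice :: "(int \<Rightarrow> int \<Rightarrow> real poly) \<Rightarrow> bool" where
  "okamoto_lattice Q \<longleftrightarrow> (\<forall>n. strip n (\<lambda>m. Q m n) (\<lambda>m. Q m (n - 1))) \<and>
     (\<forall>m n. mirror (Q (m + 1) (n - 1)) (Q m n) (Q (m + 1) n) (Q m (n + 1)) (1 + 3 * n))"

text \<open>The seed solution \<open>f\<^sub>0 = f\<^sub>1 = f\<^sub>2 = 2t/3\<close>, with all
  three parameters equal to 1/3.\<close>

lemma triple_base: "triple 1 1 1 0 0 0"
  by (simp add: triple_def bilin_def toda_def numeral_poly power2_eq_square)

lemma strip_base: "\<exists>A B. strip 0 A B \<and> A 0 = 1 \<and> B 0 = 1 \<and> A (- 1) = 1"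
proof -
  \<comment> \<open>The state at \<open>m\<close> is the triangle
    \<open>(A m, B m, A (m - 1))\<close> for \<open>n = 0\<close>. Two reflections lead to the next
    state, in either direction.\<close>
  define P where "P = (\<lambda>m :: int. \<lambda>(x, y, z). triple x y z m (- 2 * m) m)"
  define R where "R = (\<lambda>m :: int. \<lambda>(x, y, z) (x', y', z').
    z' = x \<and> mirror z x y y' (1 + 3 * m) \<and> mirror x' y' z' y (1 - 3 * (m + 1)))"
  have "\<exists>f. f 0 = (1, 1, 1) \<and> (\<forall>m. P m (f m) \<and> R m (f m) (f (m + 1)))"
  proof (rule int_chain)
    show "P 0 (1, 1, 1)" by (simp add: P_def triple_base)
  next
    fix m p assume "P m p"
    then obtain x y z where p: "p = (x, y, z)" and t: "triple x y z m (- 2 * m) m"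
      by (cases p) (auto simp: P_def)
    note t2 = triple_rotate[OF triple_rotate[OF t]]
    obtain w where w: "mirror z x y w (1 + 3 * m)" using mirror_exists_index[OF t2, of "1 + 3 * m"] by auto
    have "triple w x y m (- 1 - 2 * m) (m + 1)"
      by (rule mirror_triple_index[OF t2 w _ int_neq_0(1)]) simp_all
    from triple_rotate[OF triple_rotate[OF this]]
    have t3: "triple y w x (m + 1) m (- 1 - 2 * m)" .
    \<comment> \<open>The summand \<open>3 * 0\<close> keeps the parameter in the shape of
      \<open>int_neq_0\<close>.\<close>
    obtain v where v: "mirror y w x v (3 * m + 3 * 0 + 2)"
      using mirror_exists_index[OF t3, of "3 * m + 3 * 0 + 2"] by auto
    have "triple v w x (m + 1) (- 2 * (m + 1)) (m + 1)"
      by (rule mirror_triple_index[OF t3 v _ int_neq_0(3)]) simp_all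
    moreover have "mirror v w x y (1 - 3 * (m + 1))"
      using mirror_sym[OF v] by (simp add: algebra_simps)
    ultimately show "\<exists>q. P (m + 1) q \<and> R m p q"
      using w p by (intro exI[of _ "(v, w, x)"]) (simp add: P_def R_def)
  next
    fix m p assume "P (m + 1) p"
    then obtain x y z where p: "p = (x, y, z)" and t: "triple x y z (m + 1) (- 2 * (m + 1)) (m + 1)"
      by (cases p) (auto simp: P_def)
    obtain s where s: "mirror x y z s (1 - 3 * (m + 1) - 3 * 0)"
      using mirror_exists_index[OF t, of "1 - 3 * (m + 1) - 3 * 0"] by auto
    have "triple s y z (m + 1) m (- 1 - 2 * m)"
      by (rule mirror_triple_index[OF t s _ int_neq_0(5)]) simp_all
    note t3 = triple_rotate[OF this]
    obtain u where u: "mirror y z s u (- 1 - 3 * m)"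
      using mirror_exists_index[OF t3, of "- 1 - 3 * m"] by auto
    have "triple u z s m m (- 2 * m)"
      by (rule mirror_triple_index[OF t3 u _ int_neq_0(2)]) simp_all
    note t4 = triple_rotate[OF this]
    have "mirror u z s y (1 + 3 * m)" using mirror_sym[OF u] by (simp add: add.commute)
    then show "\<exists>q. P m q \<and> R m q p"
      using s t4 p by (intro exI[of _ "(z, s, u)"]) (simp add: P_def R_def)
  qed
  then obtain f where f: "f 0 = (1, 1, 1)" "\<And>m. P m (f m)" "\<And>m. R m (f m) (f (m + 1))"
    by blast
  define A where "A m = fst (f m)" for m
  define B where "B m = fst (snd (f m))" for m
  have R': "snd (snd (f m)) = A (m - 1)" for m
    using f(3)[of "m - 1"] by (auto simp: R_def A_def split: prod.splits)
  have fm: "f m = (A m, B m, A (m - 1))" for m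
    by (metis A_def B_def R' prod.collapse)
  have "strip 0 A B"
    unfolding strip_def
  proof (intro allI conjI)
    fix m
    show "triple (A m) (B m) (A (m - 1)) (m - 0) (- 2 * m - 0) (m + 2 * 0)"
      using f(2)[of m] by (simp add: fm P_def)
    show "mirror (A m) (B m) (A (m - 1)) (B (m - 1)) (1 - 3 * m - 3 * 0)"
      using f(3)[of "m - 1"] by (simp add: fm R_def)
    show "mirror (A (m - 1)) (A m) (B m) (B (m + 1)) (1 + 3 * m)"
      using f(3)[of m] by (simp add: fm R_def)
  qed
  moreover have "A 0 = 1" "B 0 = 1" "A (- 1) = 1" using f(1) fm[of 0] by auto
  ultimately show ?thesis by blast
qed

lemma lattice_exists: "\<exists>Q. okamoto_lattice Q \<and> Q 0 0 = 1 \<and> Q (- 1) 0 = 1 \<and> Q 0 (- 1) = 1"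
proof -
  obtain A B where AB: "strip 0 A B" "A 0 = 1" "B 0 = 1" "A (- 1) = 1" using strip_base by blast
  define P where "P = (\<lambda>n. \<lambda>(A, B). strip n A B)"
  define R where "R = (\<lambda>n :: int. \<lambda>(A, B) (A', B' :: int \<Rightarrow> real poly).
    B' = A \<and> (\<forall>m. mirror (B (m + 1)) (A m) (A (m + 1)) (A' m) (1 + 3 * n)))"
  have "\<exists>f. f 0 = (A, B) \<and> (\<forall>m. P m (f m) \<and> R m (f m) (f (m + 1)))"
  proof (rule int_chain)
    show "P 0 (A, B)" using AB by (simp add: P_def)
  next
    fix n p assume "P n p"
    then show "\<exists>q. P (n + 1) q \<and> R n p q"
      using strip_up[of n "fst p" "snd p"] by (auto simp: P_def R_def split: prod.splits)
  next
    fix n p assume "P (n + 1) p"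
    then show "\<exists>q. P n q \<and> R n q p"
      using strip_down[of n "fst p" "snd p"] by (auto simp: P_def R_def split: prod.splits)
  qed
  then obtain f where f: "f 0 = (A, B)" "\<And>m. P m (f m)" "\<And>m. R m (f m) (f (m + 1))"
    by blast
  define Q where "Q m n = fst (f n) m" for m n
  have R': "snd (f n) = (\<lambda>m. Q m (n - 1))" for n
    using f(3)[of "n - 1"] by (auto simp: R_def Q_def split: prod.splits)
  have fn: "f n = ((\<lambda>m. Q m n), (\<lambda>m. Q m (n - 1)))" for n
    by (rule prod_eqI) (simp_all add: R' Q_def)
  have "okamoto_lattice Q"
    using f(2,3) unfolding okamoto_lattice_def by (simp add: fn P_def R_def)
  moreover have "Q 0 0 = 1" "Q (- 1) 0 = 1" using f(1) AB by (simp_all add: Q_def)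
  moreover have "Q 0 (- 1) = 1" using f(1) AB fn[of 0] by auto
  ultimately show ?thesis by blast
qed


lemma lattice_facts:
  assumes "okamoto_lattice Q"
  shows "triple (Q m n) (Q m (n - 1)) (Q (m - 1) n) (m - n) (- 2 * m - n) (m + 2 * n)"
    "triple (Q (m - 1) (n - 1)) (Q m (n - 1)) (Q (m - 1) n) (m - n) (m + 2 * n - 1) (1 - 2 * m - n)"
    "mirror (Q m n) (Q m (n - 1)) (Q (m - 1) n) (Q (m - 1) (n - 1)) (1 - 3 * m - 3 * n)"
    "mirror (Q (m + 1) (n - 1)) (Q m n) (Q (m + 1) n) (Q m (n + 1)) (1 + 3 * n)"
    "mirror (Q (m - 1) n) (Q m n) (Q m (n - 1)) (Q (m + 1) (n - 1)) (1 + 3 * m)"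
    "Q m n \<noteq> 0"
proof -
  have st: "strip n (\<lambda>m. Q m n) (\<lambda>m. Q m (n - 1))" using assms by (simp add: okamoto_lattice_def)
  note f = strip_facts[OF st, of m]
  show "triple (Q m n) (Q m (n - 1)) (Q (m - 1) n) (m - n) (- 2 * m - n) (m + 2 * n)" by (rule f(1))
  then show "Q m n \<noteq> 0" by (rule triple_nonzero)
  show "mirror (Q (m + 1) (n - 1)) (Q m n) (Q (m + 1) n) (Q m (n + 1)) (1 + 3 * n)"
    using assms by (simp add: okamoto_lattice_def)
  show "triple (Q (m - 1) (n - 1)) (Q m (n - 1)) (Q (m - 1) n) (m - n) (m + 2 * n - 1) (1 - 2 * m - n)"
    "mirror (Q m n) (Q m (n - 1)) (Q (m - 1) n) (Q (m - 1) (n - 1)) (1 - 3 * m - 3 * n)"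
    "mirror (Q (m - 1) n) (Q m n) (Q m (n - 1)) (Q (m + 1) (n - 1)) (1 + 3 * m)"
    by (rule f)+
qed

section \<open>Identification of the lattice values with \<open>okamoto_Q\<close>\<close>

lemma toda_eq:
  "smult (9/2) (pderiv (pderiv z) * z - (pderiv z)^2) + [:3 * of_int j, 0, 2:] * z^2 = p
    \<longleftrightarrow> 2 * p = toda j z"
proof -
  have q: "2 * [:3 * of_int j, 0, 2:] = 4 * tX^2 + 6 * of_int j"
    by (simp add: numeral_poly of_int_poly power2_eq_square)
  have s: "2 * smult (9/2) r = 9 * r" for r :: "real poly"
    by (simp add: numeral_poly)
  have "toda j z = 2 * smult (9/2) (pderiv (pderiv z) * z - (pderiv z)^2) + 2 * [:3 * of_int j, 0, 2:] * z^2"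
    unfolding toda_def q s by (simp only: mult.commute)
  also have "\<dots> = 2 * (smult (9/2) (pderiv (pderiv z) * z - (pderiv z)^2) + [:3 * of_int j, 0, 2:] * z^2)"
    by (simp only: distrib_left mult.assoc)
  finally show ?thesis by (metis mult_cancel_left zero_neq_numeral)
qed

lemma okamoto_rec_iff:
  "okamoto_rec Q \<longleftrightarrow> Q 0 0 = 1 \<and> Q (-1) 0 = 1 \<and> Q 0 (-1) = 1 \<and> Q (-1) (-1) = [:0, sqrt 2:] \<and>
     (\<forall>m n. 2 * (Q m (n - 1) * Q m (n + 1)) = toda (m + 2 * n + 1) (Q m n)) \<and>
     (\<forall>m n. 2 * (Q (m + 1) n * Q (m - 1) n) = toda (- 2 * m - n - 1) (Q m n))"
  unfolding okamoto_rec_def toda_eq[symmetric] by (simp only: eq_commute)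

text \<open>In both recurrences the two neighbours on the left lie opposite to each other around
  \<open>Q m n\<close>, so \<open>toda_cw\<close> applies.\<close>

lemma lattice_okamoto_rec:
  assumes l: "okamoto_lattice Q" and base: "Q 0 0 = 1" "Q (- 1) 0 = 1" "Q 0 (- 1) = 1"
  shows "okamoto_rec Q"
proof -
  note f = lattice_facts[OF l]
  \<comment> \<open>Reflecting \<open>Q 0 0\<close> in the seed triangle gives
    \<open>2 * t / root2\<close>; here the normalisation of \<open>mirror\<close> meets the
    prescribed \<open>sqrt 2 * t\<close>.\<close>
  have "root2 * Q 0 0 * Q (- 1) (- 1) = bilin (Q (- 1) 0) (Q 0 (- 1))"
    using f(3)[of 0 0] by (simp add: mirror_def)
  then have "root2 * Q (- 1) (- 1) = root2 * [:0, sqrt 2:]"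
    unfolding base by (simp add: bilin_def numeral_poly)
  then have "Q (- 1) (- 1) = [:0, sqrt 2:]"
    by (metis mult_cancel_left pCons_eq_0_iff real_sqrt_eq_zero_cancel_iff zero_neq_numeral)
  moreover have "2 * (Q m (n - 1) * Q m (n + 1)) = toda (m + 2 * n + 1) (Q m n)" for m n
  proof -
    have t: "triple (Q m (n - 1)) (Q (m + 1) (n - 1)) (Q m n) (m + 1 - n) (m + 2 * n) (- 1 - 2 * m - n)"
      using f(2)[of "m + 1" n] by (simp add: algebra_simps)
    have m: "mirror (Q m (n - 1)) (Q (m + 1) (n - 1)) (Q m n) (Q (m + 1) n) (3 * m + 3 * n + 2)"
      using mirror_sym[OF f(3)[of "m + 1" n]] by (simp add: algebra_simps)
    have "2 * Q m (n - 1) * Q m (n + 1) = toda (m + 2 * n + 1) (Q m n)"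
      by (rule toda_cw[OF t m f(4) _ int_neq_0(3)]) simp_all
    then show ?thesis by (simp only: mult.assoc)
  qed
  moreover have "2 * (Q (m + 1) n * Q (m - 1) n) = toda (- 2 * m - n - 1) (Q m n)" for m n
  proof -
    have t: "triple (Q (m + 1) n) (Q (m + 1) (n - 1)) (Q m n) (m + 1 - n) (- 2 * (m + 1) - n) (m + 1 + 2 * n)"
      using f(1)[of "m + 1" n] by simp
    have m: "mirror (Q (m + 1) n) (Q (m + 1) (n - 1)) (Q m n) (Q m (n - 1)) (1 - 3 * (m + 1) - 3 * n)"
      using f(3)[of "m + 1" n] by simp
    have "2 * Q (m + 1) n * Q (m - 1) n = toda (- 2 * m - n - 1) (Q m n)"
      by (rule toda_cw[OF t m mirror_sym[OF f(5)] _ int_neq_0(5)]) simp_all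
    then show ?thesis by (simp only: mult.assoc)
  qed
  ultimately show ?thesis using base by (simp only: okamoto_rec_iff simp_thms)
qed

lemma two_step_int_induct:
  fixes p :: "int \<Rightarrow> bool"
  assumes "p (- 1)" "p 0"
    and up: "\<And>n. p (n - 1) \<Longrightarrow> p n \<Longrightarrow> p (n + 1)"
    and down: "\<And>n. p (n + 1) \<Longrightarrow> p n \<Longrightarrow> p (n - 1)"
  shows "p n"
proof -
  have "p (n - 1) \<and> p n"
  proof (induction n rule: int_induct[where k = 0])
    case base
    then show ?case using assms by simp
  next
    case (step1 i)
    then show ?case using up[of i] by simp
  next
    case (step2 i)
    then show ?case using down[of "i - 1"] by simp
  qed
  then show ?thesis ..
qed

text \<open>From the base square the columns -1 and 0 are reached first, and then every row.\<close>

lemma lattice_induct: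
  fixes P :: "int \<Rightarrow> int \<Rightarrow> bool"
  assumes base: "P 0 0" "P (- 1) 0" "P 0 (- 1)" "P (- 1) (- 1)"
    and "\<And>m n. P m (n - 1) \<Longrightarrow> P m n \<Longrightarrow> P m (n + 1)"
    and "\<And>m n. P m (n + 1) \<Longrightarrow> P m n \<Longrightarrow> P m (n - 1)"
    and "\<And>m n. P (m - 1) n \<Longrightarrow> P m n \<Longrightarrow> P (m + 1) n"
    and "\<And>m n. P (m + 1) n \<Longrightarrow> P m n \<Longrightarrow> P (m - 1) n"
  shows "P m n"
proof -
  have "P 0 n" by (rule two_step_int_induct[of "P 0"]) (use assms in blast)+
  moreover have "P (- 1) n" by (rule two_step_int_induct[of "P (- 1)"]) (use assms in blast)+
  ultimately show ?thesis
    by (intro two_step_int_induct[of "\<lambda>m. P m n" m]) (use assms in blast)+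
qed

text \<open>Each recurrence is divided by a value on which \<open>Q\<close> and \<open>Q'\<close>
  already agree, and which is nonzero as a value of \<open>Q\<close>. This makes the
  \<open>THE\<close> in \<open>okamoto_Q\<close> denote the lattice solution.\<close>

lemma okamoto_rec_unique:
  assumes Q: "okamoto_rec Q" and nz: "\<And>m n. Q m n \<noteq> 0" and Q': "okamoto_rec Q'"
  shows "Q' = Q"
proof -
  have c: "v = w" if "2 * (u * v) = t" "2 * (u * w) = t" "u \<noteq> 0" for t u v w :: "real poly"
    using that by (metis mult_cancel_left zero_neq_numeral)
  have r: "2 * (Q m (n - 1) * Q m (n + 1)) = toda (m + 2 * n + 1) (Q m n)"
      "2 * (Q m (n + 1) * Q m (n - 1)) = toda (m + 2 * n + 1) (Q m n)"
      "2 * (Q (m - 1) n * Q (m + 1) n) = toda (- 2 * m - n - 1) (Q m n)"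
      "2 * (Q (m + 1) n * Q (m - 1) n) = toda (- 2 * m - n - 1) (Q m n)"
    if "okamoto_rec Q" for Q m n
    using that by (simp_all add: okamoto_rec_iff mult.commute)
  have "Q' m n = Q m n" for m n
  proof (induction m n rule: lattice_induct)
    case (5 m n)
    show ?case using 5 r(1)[OF Q', of m n] by (intro c[OF _ r(1)[OF Q, of m n]]) (simp_all add: nz)
  next
    case (6 m n)
    show ?case using 6 r(2)[OF Q', of m n] by (intro c[OF _ r(2)[OF Q, of m n]]) (simp_all add: nz)
  next
    case (7 m n)
    show ?case using 7 r(3)[OF Q', of m n] by (intro c[OF _ r(3)[OF Q, of m n]]) (simp_all add: nz)
  next
    case (8 m n)
    show ?case using 8 r(4)[OF Q', of m n] by (intro c[OF _ r(4)[OF Q, of m n]]) (simp_all add: nz)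
  qed (use Q Q' in \<open>auto simp: okamoto_rec_def\<close>)
  then show ?thesis by blast
qed

lemma okamoto_Q: "okamoto_lattice okamoto_Q" "okamoto_rec okamoto_Q"
proof -
  obtain Q where Q: "okamoto_lattice Q" "Q 0 0 = 1" "Q (- 1) 0 = 1" "Q 0 (- 1) = 1"
    using lattice_exists by blast
  have r: "okamoto_rec Q" by (rule lattice_okamoto_rec[OF Q])
  have "okamoto_Q = Q"
    unfolding okamoto_Q_def
    by (rule the_equality) (use r okamoto_rec_unique[OF r lattice_facts(6)[OF Q(1)]] in blast)+
  then show "okamoto_lattice okamoto_Q" "okamoto_rec okamoto_Q" using Q r by simp_all
qed

lemmas okamoto_facts = lattice_facts[OF okamoto_Q(1)]

section \<open>Symmetry of the roots about 0\<close>

definition parity :: "real poly \<Rightarrow> bool" where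
  "parity p \<longleftrightarrow> pcompose p [:0, -1:] = p \<or> pcompose p [:0, -1:] = - p"

lemma pcompose_pderiv_neg: "pcompose (pderiv p) [:0, -1:] = - pderiv (pcompose p [:0, -1 :: real:])"
  by (simp add: pderiv_pcompose pderiv_pCons)

text \<open>Each term is quadratic in \<open>z\<close> and carries an even total number of
  derivatives and factors \<open>t\<close>, so all signs cancel.\<close>

lemma toda_even:
  assumes "parity z"
  shows "pcompose (toda j z) [:0, -1:] = toda j z"
proof -
  define T where "T = tX"
  have "pcompose T [:0, -1:] = - T" by (simp add: T_def pcompose_pCons)
  moreover have "pcompose (numeral k) [:0, -1:] = (numeral k :: real poly)" for k
    by (simp add: numeral_poly)
  moreover have "pcompose (of_int k) [:0, -1:] = (of_int k :: real poly)" for k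
    by (simp add: of_int_poly)
  ultimately show ?thesis
    using assms unfolding parity_def toda_def power2_eq_square T_def[symmetric]
    by (auto simp add: pcompose_mult pcompose_add pcompose_diff pcompose_pderiv_neg pderiv_minus)
qed

lemma parity_cancel:
  assumes t: "2 * (p * q) = toda j z" and p: "parity z" "parity p" "p \<noteq> 0"
  shows "parity q"
proof -
  let ?s = "\<lambda>p. pcompose p [:0, -1 :: real:]"
  have "?s (2 * (p * q)) = 2 * (p * q)" unfolding t by (rule toda_even[OF p(1)])
  then have "2 * (?s p * ?s q) = 2 * (p * q)"
    by (simp add: pcompose_mult numeral_poly pcompose_smult)
  then have e: "?s p * ?s q = p * q" by (metis mult_cancel_left zero_neq_numeral)
  from p(2) consider "?s p = p" | "?s p = - p" by (auto simp: parity_def)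
  then show ?thesis
  proof cases
    case 1
    then show ?thesis using e p(3) by (simp add: parity_def)
  next
    case 2
    then have "p * (- ?s q) = p * q" using e by simp
    then have "- ?s q = q" using p(3) by (metis mult_cancel_left)
    then show ?thesis by (metis minus_minus parity_def)
  qed
qed

lemma okamoto_parity: "parity (okamoto_Q m n)"
proof (induction m n rule: lattice_induct)
  case (5 m n)
  show ?case
    by (rule parity_cancel[of "okamoto_Q m (n - 1)" _ "m + 2 * n + 1" "okamoto_Q m n"])
      (use okamoto_Q(2) 5 okamoto_facts(6) in \<open>auto simp: okamoto_rec_iff\<close>)
next
  case (6 m n)
  show ?case
    by (rule parity_cancel[of "okamoto_Q m (n + 1)" _ "m + 2 * n + 1" "okamoto_Q m n"])
      (use okamoto_Q(2) 6 okamoto_facts(6) in \<open>auto simp: okamoto_rec_iff mult.commute[of "okamoto_Q m (n + 1)"]\<close>)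
next
  case (7 m n)
  show ?case
    by (rule parity_cancel[of "okamoto_Q (m - 1) n" _ "- 2 * m - n - 1" "okamoto_Q m n"])
      (use okamoto_Q(2) 7 okamoto_facts(6) in \<open>auto simp: okamoto_rec_iff mult.commute[of "okamoto_Q (m - 1) n"]\<close>)
next
  case (8 m n)
  show ?case
    by (rule parity_cancel[of "okamoto_Q (m + 1) n" _ "- 2 * m - n - 1" "okamoto_Q m n"])
      (use okamoto_Q(2) 8 okamoto_facts(6) in \<open>auto simp: okamoto_rec_iff\<close>)
qed (use okamoto_Q(2) in \<open>auto simp: okamoto_rec_def parity_def pcompose_pCons pcompose_1\<close>)

lemma okamoto_root_neg: "poly (okamoto_Q m n) (- t) = 0 \<longleftrightarrow> poly (okamoto_Q m n) t = 0"
proof -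
  have "poly (okamoto_Q m n) (- t) = poly (pcompose (okamoto_Q m n) [:0, -1:]) t"
    by (simp add: poly_pcompose)
  then show ?thesis using okamoto_parity[of m n] by (auto simp: parity_def)
qed

section \<open>The order of the real roots under a reflection\<close>

text \<open>Only used at roots of \<open>x y z s\<close>, so that \<open>3\<close> stands for a root of the fourth polynomial.\<close>

definition letter :: "real poly \<Rightarrow> real poly \<Rightarrow> real poly \<Rightarrow> real \<Rightarrow> nat" where
  "letter x y z t = (if poly x t = 0 then 0 else if poly y t = 0 then 1 else if poly z t = 0 then 2 else 3)"

text \<open>For \<open>p = 0\<close> the root set is infinite and the list is \<open>[]\<close> by
  default.\<close>

definition roots :: "real poly \<Rightarrow> real list" where
  "roots p = sorted_list_of_set {t. poly p t = 0}"

definition word3 :: "real poly \<Rightarrow> real poly \<Rightarrow> real poly \<Rightarrow> nat list" where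
  "word3 x y z = map (letter x y z) (roots (x * y * z))"

definition word4 :: "real poly \<Rightarrow> real poly \<Rightarrow> real poly \<Rightarrow> real poly \<Rightarrow> nat list" where
  "word4 x y z s = map (letter x y z) (roots (x * y * z * s))"

text \<open>The derivative of \<open>x y z s\<close> is negative at the letters \<open>0, 1\<close> and positive at \<open>2, 3\<close>. The flag says whether a
  positive letter is due next; since \<open>x y z s\<close> goes from \<open>-\<infinity>\<close> to \<open>\<infinity>\<close>, the first and last letter are positive.\<close>

fun alternating :: "bool \<Rightarrow> nat list \<Rightarrow> bool" where
  "alternating b [] \<longleftrightarrow> \<not> b"
| "alternating b (i # w) \<longleftrightarrow> (i \<ge> 2) = b \<and> alternating (i < 2) w"

fun fill :: "bool \<Rightarrow> nat list \<Rightarrow> nat list" where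
  "fill b [] = (if b then [3] else [])"
| "fill b (i # w) = (if b \<and> i < 2 then [3] else []) @ i # fill (i < 2) w"

lemma fill_True: "w = [] \<or> hd w < 2 \<Longrightarrow> fill True w = 3 # fill False w"
  by (cases w) auto

text \<open>Two letters \<open>3\<close> cannot be neighbours, as both are positive. So there is
  room for at most one between the other letters, and the alternation decides whether it is
  present.\<close>

lemma alternating_fill: "alternating b w \<Longrightarrow> set w \<subseteq> {..3} \<Longrightarrow> fill b (filter (\<lambda>i. i \<noteq> 3) w) = w"
proof (induction b w rule: alternating.induct)
  case (2 b i w)
  then have IH: "fill (i < 2) (filter (\<lambda>i. i \<noteq> 3) w) = w" by auto
  show ?case
  proof (cases "i = 3")
    case True
    have "filter (\<lambda>i. i \<noteq> 3) w = [] \<or> hd (filter (\<lambda>i. i \<noteq> 3) w) < 2"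
      using 2(2) True by (cases w) auto
    then show ?thesis using 2(2) True IH by (auto simp: fill_True)
  next
    case False
    then show ?thesis using 2(2) IH by auto
  qed
qed auto

lemma roots_props:
  assumes "p \<noteq> 0"
  shows "sorted_wrt (<) (roots p)" "set (roots p) = {t. poly p t = 0}"
  using poly_roots_finite[OF assms] by (simp_all add: roots_def)

lemma roots_eqI:
  assumes "sorted_wrt (<) ts" "set ts = {t. poly p t = 0}"
  shows "roots p = ts"
  unfolding roots_def using assms
  by (metis List.finite_set sorted_list_of_set.idem_if_sorted_distinct strict_sorted_iff)

lemma roots_filter:
  assumes "p \<noteq> 0" "\<And>t. poly q t = 0 \<longleftrightarrow> poly p t = 0 \<and> P t"
  shows "roots q = filter P (roots p)"
  by (rule roots_eqI) (use assms roots_props[OF assms(1)] in \<open>auto simp: sorted_wrt_filter\<close>)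

text \<open>Between consecutive roots \<open>g\<close> has constant sign, so the derivatives at
  simple roots alternate in sign. The induction runs over the roots to the right of
  \<open>u\<close>; \<open>b\<close> says that \<open>g\<close> is negative just after
  \<open>u\<close>, which need not be a root itself.\<close>

lemma alternating_roots:
  fixes g :: "real poly" and ts :: "real list"
  assumes "\<And>t. poly g t = 0 \<Longrightarrow> poly (pderiv g) t \<noteq> 0 \<and> (l t \<ge> 2 \<longleftrightarrow> poly (pderiv g) t > 0)"
    and top: "\<And>t. t \<ge> B \<Longrightarrow> poly g t > 0"
    and "sorted_wrt (<) ts" "set ts = {t. t > u \<and> poly g t = 0}"
    and "d > 0" "\<And>h. 0 < h \<Longrightarrow> h < d \<Longrightarrow> (if b then poly g (u + h) < 0 else poly g (u + h) > 0)"
  shows "alternating b (map l ts)"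
  using assms(3-)
proof (induction ts arbitrary: u b d)
  case Nil
  \<comment> \<open>With no root left, \<open>g\<close> keeps its sign, and it is positive for large
    arguments.\<close>
  have "\<not> b"
  proof
    assume b
    then have "poly g (u + d / 2) < 0" using Nil(3) Nil(4)[of "d / 2"] by auto
    moreover have "poly g (max (u + d) B) > 0" using top by simp
    ultimately obtain t where "t > u + d / 2" "poly g t = 0"
      using poly_IVT_pos[of "u + d / 2" "max (u + d) B" g] Nil(3) by (auto simp: less_max_iff_disj)
    then have "t \<in> {t. u < t \<and> poly g t = 0}" using Nil(3) by auto
    then show False unfolding Nil(2)[symmetric] by simp
  qed
  then show ?case by simp
next
  case (Cons v ts)
  have v: "v > u" "poly g v = 0" using Cons.prems(2) by auto
  have no: "poly g t \<noteq> 0" if "u < t" "t < v" for t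
    using Cons.prems(1,2) that by (auto dest!: equalityD2 subsetD[of _ _ t])
  have D: "(poly g has_real_derivative poly (pderiv g) v) (at v)" by (rule poly_DERIV)
  have set: "set ts = {t. t > v \<and> poly g t = 0}"
    using Cons.prems(1,2) v by (auto 0 3)
  \<comment> \<open>A point between \<open>u\<close> and \<open>v\<close>, as close to
    \<open>u\<close> as desired, where \<open>g\<close> has the sign given by
    \<open>b\<close>.\<close>
  have left: "\<exists>w. u < w \<and> w < v \<and> w < t \<and> (if b then poly g w < 0 else poly g w > 0)" if "t > u" for t
  proof -
    define h where "h = min (d / 2) (min ((t - u) / 2) ((v - u) / 2))"
    have "h \<le> d / 2" "h \<le> (t - u) / 2" "h \<le> (v - u) / 2" unfolding h_def by linarith+
    moreover have "0 < h" using v that Cons.prems(3) by (simp add: h_def)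
    ultimately have "0 < h" "h < d" "u + h < t" "u + h < v" using v that Cons.prems(3) by simp_all
    then show ?thesis using Cons.prems(4)[of h] by (intro exI[of _ "u + h"]) auto
  qed
  show ?case
  proof (cases "poly (pderiv g) v > 0")
    case True
    obtain e where e: "e > 0" "\<And>h. 0 < h \<Longrightarrow> h < e \<Longrightarrow> poly g (v - h) < 0"
      using DERIV_pos_inc_left[OF D True] unfolding v(2) by blast
    obtain e' where e': "e' > 0" "\<And>h. 0 < h \<Longrightarrow> h < e' \<Longrightarrow> poly g (v + h) > 0"
      using DERIV_pos_inc_right[OF D True] unfolding v(2) by blast
    have b
    proof (rule ccontr)
      assume nb: "\<not> b"
      define h where "h = min (e / 2) ((v - u) / 2)"
      have "h \<le> e / 2" "h \<le> (v - u) / 2" unfolding h_def by linarith+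
      moreover have "0 < h" using e(1) v(1) by (simp add: h_def)
      ultimately have h: "0 < h" "h < e" "u < v - h" using e(1) v(1) by simp_all
      obtain w where w: "u < w" "w < v - h" "poly g w > 0" using left[OF h(3)] nb by auto
      \<comment> \<open>Opposite signs after \<open>u\<close> and before \<open>v\<close> would
        force a further root in between.\<close>
      obtain t where "w < t" "t < v - h" "poly g t = 0"
        using poly_IVT_neg[OF w(2,3)] e(2)[OF h(1,2)] by auto
      then show False using no[of t] w h by auto
    qed
    moreover have "alternating False (map l ts)"
      by (rule Cons.IH[OF _ set e'(1)]) (use Cons.prems(1) e' in auto)
    moreover have "l v \<ge> 2" using assms(1)[OF v(2)] True by simp
    ultimately show ?thesis by simp
  next
    case False
    then have neg: "poly (pderiv g) v < 0" using assms(1)[OF v(2)] by auto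
    obtain e where e: "e > 0" "\<And>h. 0 < h \<Longrightarrow> h < e \<Longrightarrow> poly g (v - h) > 0"
      using DERIV_neg_dec_left[OF D neg] unfolding v(2) by blast
    obtain e' where e': "e' > 0" "\<And>h. 0 < h \<Longrightarrow> h < e' \<Longrightarrow> poly g (v + h) < 0"
      using DERIV_neg_dec_right[OF D neg] unfolding v(2) by blast
    have "\<not> b"
    proof
      assume b: b
      define h where "h = min (e / 2) ((v - u) / 2)"
      have "h \<le> e / 2" "h \<le> (v - u) / 2" unfolding h_def by linarith+
      moreover have "0 < h" using e(1) v(1) by (simp add: h_def)
      ultimately have h: "0 < h" "h < e" "u < v - h" using e(1) v(1) by simp_all
      obtain w where w: "u < w" "w < v - h" "poly g w < 0" using left[OF h(3)] b by auto
      obtain t where "w < t" "t < v - h" "poly g t = 0"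
        using poly_IVT_pos[OF w(2,3)] e(2)[OF h(1,2)] by auto
      then show False using no[of t] w h by auto
    qed
    moreover have "alternating True (map l ts)"
      by (rule Cons.IH[OF _ set e'(1)]) (use Cons.prems(1) e' in auto)
    moreover have "\<not> l v \<ge> 2" using assms(1)[OF v(2)] False by simp
    ultimately show ?thesis by simp
  qed
qed

lemma logderiv_tendsto_0:
  assumes "p \<noteq> (0 :: real poly)"
  shows "((\<lambda>t. poly (pderiv p) t / poly p t) \<longlongrightarrow> 0) at_infinity"
proof (cases "degree p = 0")
  case True
  then have "pderiv p = 0" by (simp add: pderiv_eq_0_iff)
  then show ?thesis by simp
next
  case False
  then show ?thesis using assms
    by (intro poly_divide_tendsto_0_at_infinity) (simp add: degree_pderiv)
qed

text \<open>Up to the positive square of \<open>z * y\<close>, the expression is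
  \<open>2 * t\<close> plus three times a difference of logarithmic derivatives, and these tend to
  0.\<close>

lemma bilin_sign_at_infinity:
  assumes "y \<noteq> 0" "z \<noteq> 0"
  obtains B where "\<And>t. t \<ge> B \<Longrightarrow> poly (bilin z y * (z * y)) t > 0"
    "\<And>t. t \<le> - B \<Longrightarrow> poly (bilin z y * (z * y)) t < 0"
proof -
  let ?r = "\<lambda>t. poly (pderiv z) t / poly z t - poly (pderiv y) t / poly y t"
  have "(?r \<longlongrightarrow> 0 - 0) at_infinity" using assms by (intro tendsto_diff logderiv_tendsto_0)
  then have "\<forall>\<^sub>F t in at_infinity. \<bar>?r t\<bar> < 1/2"
    by (auto dest!: tendstoD[of _ _ _ "1/2"] simp: dist_real_def)
  then obtain b where b: "\<And>t. norm t \<ge> b \<Longrightarrow> \<bar>?r t\<bar> < 1/2"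
    unfolding eventually_at_infinity by auto
  define S where "S = {t. poly (z * y) t = 0}"
  have "finite S" unfolding S_def using assms by (intro poly_roots_finite) simp
  then have "\<bar>t\<bar> < Max (insert 0 (abs ` S)) + 1" if "t \<in> S" for t
  proof -
    have "\<bar>t\<bar> \<le> Max (insert 0 (abs ` S))" by (rule Max_ge) (use \<open>finite S\<close> that in auto)
    then show ?thesis by linarith
  qed
  then obtain c where c: "\<And>t. poly (z * y) t = 0 \<Longrightarrow> \<bar>t\<bar> < c" unfolding S_def by blast
  \<comment> \<open>Beyond \<open>B\<close> there is no root of \<open>z * y\<close>, and
    \<open>|2 * t|\<close> is at least 2 while the correction stays below 3/2.\<close>
  define B where "B = max b (max c 1)"
  have e: "poly (bilin z y * (z * y)) t = (2 * t + 3 * ?r t) * (poly (z * y) t)^2" if "\<bar>t\<bar> \<ge> B" for t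
  proof -
    have "poly (z * y) t \<noteq> 0" using c[of t] that by (auto simp: B_def)
    then show ?thesis by (simp add: bilin_def field_simps power2_eq_square)
  qed
  have pos: "(poly (z * y) t)^2 > 0" if "\<bar>t\<bar> \<ge> B" for t
    using c[of t] that by (auto simp: B_def)
  show ?thesis
  proof (rule that[of B])
    fix t assume t: "t \<ge> B"
    then have "\<bar>t\<bar> \<ge> B" "t \<ge> 1" "\<bar>?r t\<bar> < 1/2" using b[of t] by (auto simp: B_def)
    then show "poly (bilin z y * (z * y)) t > 0"
      unfolding e[OF \<open>\<bar>t\<bar> \<ge> B\<close>] abs_less_iff by (intro mult_pos_pos pos) auto
  next
    fix t assume t: "t \<le> - B"
    then have "\<bar>t\<bar> \<ge> B" "t \<le> - 1" "\<bar>?r t\<bar> < 1/2" using b[of t] by (auto simp: B_def)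
    then show "poly (bilin z y * (z * y)) t < 0"
      unfolding e[OF \<open>\<bar>t\<bar> \<ge> B\<close>] abs_less_iff by (intro mult_neg_pos pos) auto
  qed
qed

lemma coprime_no_common_root:
  assumes "coprime p q" "poly p t = 0"
  shows "poly q t \<noteq> (0 :: real)"
proof
  assume "poly q t = 0"
  then have "[:- t, 1:] dvd p" "[:- t, 1:] dvd q" using assms(2) by (auto simp: poly_eq_0_iff_dvd)
  then have "is_unit [:- t, 1:]" using assms(1) coprime_common_divisor by blast
  then show False by (simp add: is_unit_iff_degree)
qed

lemma triple_roots:
  assumes "triple x y z i j k"
  shows "poly x t = 0 \<Longrightarrow> poly y t \<noteq> 0 \<and> poly z t \<noteq> 0 \<and> poly (pderiv x) t \<noteq> 0"
    "poly y t = 0 \<Longrightarrow> poly x t \<noteq> 0 \<and> poly z t \<noteq> 0 \<and> poly (pderiv y) t \<noteq> 0"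
    "poly z t = 0 \<Longrightarrow> poly x t \<noteq> 0 \<and> poly y t \<noteq> 0 \<and> poly (pderiv z) t \<noteq> 0"
proof -
  have "coprime x y" "coprime y x" "coprime y z" "coprime z y" "coprime z x" "coprime x z"
    "coprime x (pderiv x)" "coprime y (pderiv y)" "coprime z (pderiv z)"
    using assms by (simp_all add: triple_def coprime_commute)
  note c = this[THEN coprime_no_common_root]
  show "poly x t = 0 \<Longrightarrow> poly y t \<noteq> 0 \<and> poly z t \<noteq> 0 \<and> poly (pderiv x) t \<noteq> 0" using c by blast
  show "poly y t = 0 \<Longrightarrow> poly x t \<noteq> 0 \<and> poly z t \<noteq> 0 \<and> poly (pderiv y) t \<noteq> 0" using c by blast
  show "poly z t = 0 \<Longrightarrow> poly x t \<noteq> 0 \<and> poly y t \<noteq> 0 \<and> poly (pderiv z) t \<noteq> 0" using c by blast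
qed

lemma mirror_poly:
  assumes "mirror x y z s a"
  shows "sqrt 2 * poly x t * poly s t = 2 * t * poly z t * poly y t
      + 3 * (poly (pderiv z) t * poly y t - poly z t * poly (pderiv y) t)"
    "sqrt 2 * (poly x t * poly (pderiv s) t - poly s t * poly (pderiv x) t) = 2 * of_int a * poly y t * poly z t"
proof -
  have "poly (root2 * x * s) t = poly (bilin z y) t"
    "poly (root2 * (x * pderiv s - s * pderiv x)) t = poly (2 * of_int a * y * z) t"
    using assms unfolding mirror_def by simp_all
  then show "sqrt 2 * poly x t * poly s t = 2 * t * poly z t * poly y t
      + 3 * (poly (pderiv z) t * poly y t - poly z t * poly (pderiv y) t)"
    "sqrt 2 * (poly x t * poly (pderiv s) t - poly s t * poly (pderiv x) t) = 2 * of_int a * poly y t * poly z t"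
    by (simp_all add: bilin_def algebra_simps of_int_poly)
qed

lemma mirror_roots:
  assumes t: "triple x y z i j k" and m: "mirror x y z s a" and a: "a \<noteq> 0" and s: "poly s t = 0"
  shows "poly x t \<noteq> 0" "poly y t \<noteq> 0" "poly z t \<noteq> 0" "poly (pderiv s) t \<noteq> 0"
proof -
  show y: "poly y t \<noteq> 0" and z: "poly z t \<noteq> 0" and "poly (pderiv s) t \<noteq> 0"
    using mirror_coprime[OF t m a, unfolded coprime_commute[of z]] s coprime_no_common_root by blast+
  show "poly x t \<noteq> 0" using mirror_poly(2)[OF m, of t] s y z a by auto
qed

text \<open>At a root only the summand that differentiates the vanishing factor survives. The
  relations of \<open>mirror\<close> turn it, up to \<open>sqrt 2\<close>, into a multiple of a
  square: negative at roots of \<open>x\<close> and \<open>y\<close>, positive at roots of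
  \<open>z\<close> and \<open>s\<close>. For \<open>x\<close> and \<open>s\<close> the multiple has
  the sign of \<open>- a\<close> and \<open>a\<close>.\<close>

lemma word4_alternating:
  assumes t: "triple x y z i j k" and m: "mirror x y z s a" and a: "a > 0"
  shows "alternating True (word4 x y z s)"
proof -
  define g where "g = x * y * z * s"
  have nz: "x \<noteq> 0" "y \<noteq> 0" "z \<noteq> 0" using triple_nonzero[OF t] .
  have "s \<noteq> 0" using mirror_coprime[OF t m] a by auto
  then have g0: "g \<noteq> 0" using nz by (simp add: g_def)
  have pg: "sqrt 2 * poly g t = poly (bilin z y * (z * y)) t" for t
  proof -
    have "root2 * x * s = bilin z y" using m by (simp add: mirror_def)
    then have "poly (bilin z y) t = sqrt 2 * poly x t * poly s t" by (metis poly_mult poly_pCons poly_0 mult_zero_right add_0_right)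
    then show ?thesis by (simp add: g_def)
  qed
  obtain B where B: "\<And>t. t \<ge> B \<Longrightarrow> poly (bilin z y * (z * y)) t > 0"
    "\<And>t. t \<le> - B \<Longrightarrow> poly (bilin z y * (z * y)) t < 0"
    using bilin_sign_at_infinity[OF nz(2,3)] by metis
  have top: "poly g t > 0" if "t \<ge> B" for t
    using B(1)[OF that] unfolding pg[symmetric] by (simp add: zero_less_mult_iff)
  have bot: "poly g t < 0" if "t \<le> - B" for t
    using B(2)[OF that] unfolding pg[symmetric] by (simp add: mult_less_0_iff)
  have der: "poly (pderiv g) t \<noteq> 0 \<and> (letter x y z t \<ge> 2 \<longleftrightarrow> poly (pderiv g) t > 0)" if g: "poly g t = 0" for t
  proof -
    define X Y Z S X1 Y1 Z1 S1 where d: "X = poly x t" "Y = poly y t" "Z = poly z t" "S = poly s t"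
      "X1 = poly (pderiv x) t" "Y1 = poly (pderiv y) t" "Z1 = poly (pderiv z) t" "S1 = poly (pderiv s) t"
    define G where "G = poly (pderiv g) t"
    have G: "G = X1 * Y * Z * S + X * Y1 * Z * S + X * Y * Z1 * S + X * Y * Z * S1"
      by (simp add: G_def g_def d pderiv_mult algebra_simps)
    define r where "r = sqrt 2"
    have r: "r > 0" by (simp add: r_def)
    have m1: "r * X * S = 2 * t * Z * Y + 3 * (Z1 * Y - Z * Y1)"
      and m2: "r * (X * S1 - S * X1) = 2 * of_int a * Y * Z"
      using mirror_poly[OF m, of t] by (simp_all add: d r_def)
    have "X = 0 \<or> Y = 0 \<or> Z = 0 \<or> S = 0" using g by (auto simp: g_def d)
    then consider "X = 0" | "X \<noteq> 0" "Y = 0" | "X \<noteq> 0" "Y \<noteq> 0" "Z = 0" | "X \<noteq> 0" "Y \<noteq> 0" "Z \<noteq> 0" "S = 0"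
      by blast
    then have "G \<noteq> 0 \<and> (letter x y z t \<ge> 2 \<longleftrightarrow> G > 0)"
    proof cases
      case 1
      then have "Y \<noteq> 0" "Z \<noteq> 0" using triple_roots(1)[OF t, of t] by (auto simp: d)
      moreover have "r * G = - (2 * of_int a) * (Y * Z)^2" using 1 m2 unfolding G by algebra
      ultimately have "r * G < 0" using a by (simp add: mult_neg_pos)
      then have "G < 0" using r by (simp add: mult_less_0_iff)
      then show ?thesis using 1 by (simp add: letter_def d)
    next
      case 2
      then have "Y1 \<noteq> 0" "Z \<noteq> 0" using triple_roots(2)[OF t, of t] by (auto simp: d)
      moreover have "r * G = - 3 * (Y1 * Z)^2" using 2(2) m1 unfolding G by algebra
      ultimately have "r * G < 0" by simp
      then have "G < 0" using r by (simp add: mult_less_0_iff)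
      then show ?thesis using 2 by (simp add: letter_def d)
    next
      case 3
      then have "Z1 \<noteq> 0" using triple_roots(3)[OF t, of t] by (auto simp: d)
      moreover have "r * G = 3 * (Y * Z1)^2" using 3(3) m1 unfolding G by algebra
      ultimately have "r * G > 0" using 3 by simp
      then have "G > 0" using r by (simp add: zero_less_mult_iff)
      then show ?thesis using 3 by (simp add: letter_def d)
    next
      case 4
      have "r * G = (2 * of_int a) * (Y * Z)^2" using 4(4) m2 unfolding G by algebra
      then have "r * G > 0" using 4 a by simp
      then have "G > 0" using r by (simp add: zero_less_mult_iff)
      then show ?thesis using 4 by (simp add: letter_def d)
    qed
    then show ?thesis by (simp add: G_def)
  qed
  have "alternating True (map (letter x y z) (roots g))"
  \<comment> \<open>All roots lie to the right of \<open>- B\<close>, and \<open>g\<close> is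
    negative up to there.\<close>
  proof (rule alternating_roots[OF der top, where u = "- B - 1" and d = 1])
    show "set (roots g) = {t. - B - 1 < t \<and> poly g t = 0}"
    proof -
      have "- B - 1 < t" if "poly g t = 0" for t
        using bot[of t] that by (cases "t \<le> - B") auto
      then show ?thesis unfolding roots_props(2)[OF g0] by blast
    qed
    show "if True then poly g (- B - 1 + h) < 0 else 0 < poly g (- B - 1 + h)" if "0 < h" "h < 1" for h
      using bot that by simp
  qed (use roots_props[OF g0] in auto)
  then show ?thesis by (simp add: word4_def g_def)
qed

lemma word4_fill:
  assumes t: "triple x y z i j k" and m: "mirror x y z s a" and a: "a > 0"
  shows "word4 x y z s = fill True (word3 x y z)"
proof -
  have nz: "x \<noteq> 0" "y \<noteq> 0" "z \<noteq> 0" using triple_nonzero[OF t] .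
  have s: "s \<noteq> 0" using mirror_coprime[OF t m] a by auto
  have "roots (x * y * z) = filter (\<lambda>t. letter x y z t \<noteq> 3) (roots (x * y * z * s))"
    by (rule roots_filter) (use nz s in \<open>auto simp: letter_def\<close>)
  then have "word3 x y z = filter (\<lambda>i. i \<noteq> 3) (word4 x y z s)"
    by (simp add: word3_def word4_def filter_map o_def)
  moreover have "set (word4 x y z s) \<subseteq> {..3}" by (auto simp: word4_def letter_def)
  ultimately show ?thesis using alternating_fill[OF word4_alternating[OF assms]] by simp
qed

text \<open>By \<open>word4_fill\<close> the positions of the roots of \<open>s\<close> are forced;
  it remains to delete the roots of \<open>x\<close> and to rename those of
  \<open>s\<close>.\<close>

lemma word3_mirror:
  assumes t: "triple x y z i j k" and m: "mirror x y z s a" and a: "a > 0"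
  shows "word3 s y z = map (\<lambda>i. if i = 3 then 0 else i) (filter (\<lambda>i. i \<noteq> 0) (fill True (word3 x y z)))"
proof -
  have nz: "x \<noteq> 0" "y \<noteq> 0" "z \<noteq> 0" using triple_nonzero[OF t] .
  have s: "s \<noteq> 0" using mirror_coprime[OF t m] a by auto
  have sr: "poly s t = 0 \<Longrightarrow> poly x t \<noteq> 0 \<and> poly y t \<noteq> 0 \<and> poly z t \<noteq> 0" for t
    using mirror_roots[OF t m] a by auto
  let ?R = "roots (x * y * z * s)"
  have L: "letter x y z r \<noteq> 0 \<longleftrightarrow> poly x r \<noteq> 0" for r by (simp add: letter_def)
  have "roots (s * y * z) = filter (\<lambda>t. poly x t \<noteq> 0) ?R"
  proof (rule roots_filter)
    fix r
    have "poly s r = 0 \<Longrightarrow> poly x r \<noteq> 0" "poly y r = 0 \<Longrightarrow> poly x r \<noteq> 0" "poly z r = 0 \<Longrightarrow> poly x r \<noteq> 0"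
      using sr[of r] triple_roots(2,3)[OF t, of r] by simp_all
    then show "poly (s * y * z) r = 0 \<longleftrightarrow> poly (x * y * z * s) r = 0 \<and> poly x r \<noteq> 0"
      by auto
  qed (use nz s in simp)
  moreover have "letter s y z t = (if letter x y z t = 3 then 0 else letter x y z t)"
    if "t \<in> set (filter (\<lambda>t. poly x t \<noteq> 0) ?R)" for t
  proof (cases "poly s t = 0")
    case True
    then show ?thesis using sr[OF True] by (simp add: letter_def)
  next
    case False
    then have "poly y t = 0 \<or> poly z t = 0" "poly x t \<noteq> 0"
      using that nz s roots_props(2)[of "x * y * z * s"] by auto
    then show ?thesis using False by (auto simp: letter_def)
  qed
  ultimately have "word3 s y z = map (\<lambda>t. if letter x y z t = 3 then 0 else letter x y z t) (filter (\<lambda>t. poly x t \<noteq> 0) ?R)"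
    unfolding word3_def by (simp only: cong: map_cong)
  then show ?thesis
    unfolding word4_fill[OF assms, symmetric] by (simp only: word4_def filter_map map_map o_def L)
qed

lemma word3_rotate:
  assumes t: "triple x y z i j k"
  shows "word3 y z x = map (\<lambda>i. if i = 0 then 2 else i - 1) (word3 x y z)"
proof -
  have e: "y * z * x = x * y * z" by (simp only: mult_ac)
  have "letter y z x r = (if letter x y z r = 0 then 2 else letter x y z r - 1)"
    if "r \<in> set (roots (x * y * z))" for r
  proof -
    have r: "poly (x * y * z) r = 0"
      using that triple_nonzero[OF t] roots_props(2)[of "x * y * z"] by auto
    consider "poly x r = 0" "poly y r \<noteq> 0" "poly z r \<noteq> 0" | "poly y r = 0" "poly x r \<noteq> 0" "poly z r \<noteq> 0"
      | "poly z r = 0" "poly x r \<noteq> 0" "poly y r \<noteq> 0"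
      using r triple_roots[OF t, of r] unfolding poly_mult mult_eq_0_iff by blast
    then show ?thesis by cases (simp_all add: letter_def)
  qed
  then show ?thesis
    unfolding word3_def e map_map o_def by (intro map_cong refl)
qed

section \<open>Root words in the sector\<close>

text \<open>The counterpart of \<open>pw\<close> for an arbitrary alphabet, used for words of root
  labels.\<close>

definition repeat_word :: "nat \<Rightarrow> 'a list \<Rightarrow> 'a list" where
  "repeat_word k w = concat (replicate k w)"

lemma repeat_word_simps [simp]:
  "repeat_word 0 w = []" "repeat_word (Suc k) w = w @ repeat_word k w" "map f (repeat_word k w) = repeat_word k (map f w)"
  "filter P (repeat_word k w) = repeat_word k (filter P w)" "length (repeat_word k w) = k * length w"
  by (simp_all add: repeat_word_def map_concat filter_concat length_concat sum_list_replicate)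

lemma rep_Nil [simp]: "repeat_word k [] = []"
  by (induction k) auto

lemma rep_add: "repeat_word (i + j) w = repeat_word i w @ repeat_word j w"
  by (induction i) auto

lemma rep_shift: "repeat_word k (a # w) @ a # r = a # repeat_word k (w @ [a]) @ r"
  by (induction k) auto

text \<open>By the hypothesis the block \<open>u\<close> brings the flag back to \<open>b\<close>,
  so the blocks can be filled independently.\<close>

lemma fill_rep:
  assumes "\<And>r. fill b (u @ r) = u' @ fill b r"
  shows "fill b (repeat_word k u @ r) = repeat_word k u' @ fill b r"
  by (induction k) (simp_all add: assms)

definition rot :: "nat list \<Rightarrow> nat list" where
  "rot w = map (\<lambda>i. if i = 0 then 2 else i - 1) w"

definition refl_word :: "nat list \<Rightarrow> nat list" where
  "refl_word w = map (\<lambda>i. if i = 3 then 0 else i) (filter (\<lambda>i. i \<noteq> 0) (fill True w))"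

text \<open>Closed forms in the sector coordinates \<open>k = m + n\<close>, \<open>l = - n\<close>:
  here for the triangle \<open>Q m n, Q m (n - 1), Q (m - 1) n\<close>, in \<open>lower_word\<close>
  for the adjacent \<open>Q (m + 1) (n - 1), Q m n, Q m (n - 1)\<close>, and in
  \<open>rhombus_word\<close> for the rhombus whose edge defines \<open>q\<close> at
  \<open>(m + 1, n - 1)\<close>.\<close>

definition upper_word :: "nat \<Rightarrow> nat \<Rightarrow> nat list" where
  "upper_word k l = (let \<mu> = k div 2 in
     if even k then repeat_word \<mu> [0, 1, 2] @ repeat_word l [0] @ repeat_word \<mu> [2, 1, 0]
     else repeat_word \<mu> [0, 1, 2] @ [0] @ repeat_word l [1, 2] @ [1, 0] @ repeat_word \<mu> [2, 1, 0])"

definition lower_word :: "nat \<Rightarrow> nat \<Rightarrow> nat list" where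
  "lower_word k l = (let \<mu> = k div 2 in
     if even k then repeat_word \<mu> [0, 1, 2] @ [0] @ repeat_word l [1, 0] @ repeat_word \<mu> [2, 1, 0]
     else repeat_word \<mu> [0, 1, 2] @ [0, 1, 2] @ repeat_word l [2] @ [1, 0] @ repeat_word \<mu> [2, 1, 0])"

definition rhombus_word :: "nat \<Rightarrow> nat \<Rightarrow> nat list" where
  "rhombus_word k l = (let \<mu> = k div 2 in
     if even k then repeat_word \<mu> [2, 0, 3, 1] @ [2] @ repeat_word l [0, 2] @ repeat_word \<mu> [1, 3, 0, 2]
     else repeat_word \<mu> [2, 0, 3, 1] @ [2, 0] @ repeat_word l [3, 1] @ [3, 1, 3, 0, 2] @ repeat_word \<mu> [1, 3, 0, 2])"

lemmas fill_reps =
  fill_rep[where b = True and u = "[1, 2, 0]" and u' = "[3, 1, 2, 0]", simplified]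
  fill_rep[where b = True and u = "[0, 2, 1]" and u' = "[3, 0, 2, 1]", simplified]
  fill_rep[where b = True and u = "[0, 2, 1]" and u' = "[3, 0, 2, 1]" and r = "[]", simplified]
  fill_rep[where b = True and u = "[2, 0]" and u' = "[2, 0]", simplified]
  fill_rep[where b = True and u = "[2, 1]" and u' = "[2, 1]", simplified]
  fill_rep[where b = True and u = "[0]" and u' = "[3, 0]", simplified]
  fill_rep[where b = True and u = "[1]" and u' = "[3, 1]", simplified]
  fill_rep[where b = True and u = "[2, 0, 1]" and u' = "[2, 0, 3, 1]", simplified]
  fill_rep[where b = False and u = "[0, 2]" and u' = "[0, 2]", simplified]
  fill_rep[where b = False and u = "[1, 0, 2]" and u' = "[1, 3, 0, 2]", simplified]
  fill_rep[where b = False and u = "[1, 0, 2]" and u' = "[1, 3, 0, 2]" and r = "[]", simplified]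

lemma rep_shifts:
  "repeat_word k [a] @ a # r = a # repeat_word k [a] @ r"
  "repeat_word k [a, b] @ a # r = a # repeat_word k [b, a] @ r"
  "repeat_word k [a, b, c] @ a # r = a # repeat_word k [b, c, a] @ r"
  "repeat_word k [a, b, c, d] @ a # r = a # repeat_word k [b, c, d, a] @ r"
  by (simp_all add: rep_shift)

text \<open>Powers are filled block by block with \<open>fill_reps\<close>;
  \<open>rep_shifts\<close> then conjugates the blocks until both sides agree. The next three
  identities are proved alike and move the closed forms one step in \<open>l\<close> or in
  \<open>k\<close>.\<close>

lemma fill_rhombus: "fill True (rot (lower_word k l)) = rhombus_word k l"
  by (simp add: rot_def lower_word_def rhombus_word_def Let_def fill_reps) (simp add: rep_shifts)

lemma refl_upper: "refl_word (rot (rot (upper_word k l))) = lower_word k l"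
  by (simp add: refl_word_def rot_def lower_word_def upper_word_def Let_def fill_reps) (simp add: rep_shifts)

lemma refl_lower_right: "rot (rot (refl_word (rot (lower_word k l)))) = upper_word k (Suc l)"
  unfolding refl_word_def fill_rhombus
  by (simp add: rot_def rhombus_word_def upper_word_def Let_def rep_shifts)

lemma refl_lower_left: "refl_word (rot (rot (lower_word k l))) = upper_word (Suc k) l"
  by (cases "even k", simp_all add: refl_word_def rot_def lower_word_def upper_word_def Let_def fill_reps)
    (simp_all add: rep_shifts)

section \<open>Propagation of the root words through the sector\<close>

lemma word3_refl:
  assumes "triple x y z i j k" "mirror x y z s a" "a > 0"
  shows "word3 s y z = refl_word (word3 x y z)"
  using word3_mirror[OF assms] by (simp add: refl_word_def)

lemma word3_rot: "triple x y z i j k \<Longrightarrow> word3 y z x = rot (word3 x y z)"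
  by (simp add: word3_rotate rot_def)

abbreviation upper_triangle_word :: "int \<Rightarrow> int \<Rightarrow> nat list" where
  "upper_triangle_word m n \<equiv> word3 (okamoto_Q m n) (okamoto_Q m (n - 1)) (okamoto_Q (m - 1) n)"

abbreviation lower_triangle_word :: "int \<Rightarrow> int \<Rightarrow> nat list" where
  "lower_triangle_word m n \<equiv> word3 (okamoto_Q (m + 1) (n - 1)) (okamoto_Q m n) (okamoto_Q m (n - 1))"

lemma lower_triangle:
  "triple (okamoto_Q (m + 1) (n - 1)) (okamoto_Q m n) (okamoto_Q m (n - 1)) (m + 2 * n) (- 1 - 2 * m - n) (m + 1 - n)"
  using triple_rotate[OF okamoto_facts(2)[of "m + 1" n]] by (simp add: algebra_simps)

text \<open>The vertex \<open>Q (m - 1) n\<close> is reflected; the parameter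
  \<open>1 + 3 * m\<close> is positive.\<close>

lemma lower_triangle_word:
  assumes "upper_triangle_word m n = w" "m \<ge> 0"
  shows "lower_triangle_word m n = refl_word (rot (rot w))"
proof -
  note t = okamoto_facts(1)[of m n]
  note t1 = triple_rotate[OF t]
  note t2 = triple_rotate[OF t1]
  have "lower_triangle_word m n = refl_word (word3 (okamoto_Q (m - 1) n) (okamoto_Q m n) (okamoto_Q m (n - 1)))"
    by (rule word3_refl[OF t2 okamoto_facts(5)]) (use assms in simp)
  then show ?thesis using assms word3_rot[OF t] word3_rot[OF t1] by simp
qed

lemma mirror_lower_right:
  "mirror (okamoto_Q m n) (okamoto_Q m (n - 1)) (okamoto_Q (m + 1) (n - 1)) (okamoto_Q (m + 1) (n - 2)) (2 - 3 * n)"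
  using mirror_sym[OF okamoto_facts(4)[of m "n - 1"]] by (simp add: algebra_simps)

text \<open>The step keeps \<open>k\<close> and raises \<open>l\<close>; the parameter
  \<open>2 - 3 * n\<close> is positive.\<close>

lemma upper_triangle_word_right:
  assumes "lower_triangle_word m n = w" "n \<le> 0"
  shows "upper_triangle_word (m + 1) (n - 1) = rot (rot (refl_word (rot w)))"
proof -
  note t = triple_rotate[OF lower_triangle[of m n]]
  have a: "2 - 3 * n \<noteq> 0" by presburger
  have t': "triple (okamoto_Q (m + 1) (n - 2)) (okamoto_Q m (n - 1)) (okamoto_Q (m + 1) (n - 1)) (- 1 - 2 * m - n) (m - 1 + 2 * n) (m + 2 - n)"
    by (rule mirror_triple_index[OF t mirror_lower_right _ a]) simp_all
  have "word3 (okamoto_Q (m + 1) (n - 2)) (okamoto_Q m (n - 1)) (okamoto_Q (m + 1) (n - 1)) = refl_word (rot w)"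
    using word3_refl[OF t mirror_lower_right] word3_rot[OF lower_triangle[of m n]] assms by simp
  then show ?thesis using word3_rot[OF t'] word3_rot[OF triple_rotate[OF t']] by simp
qed

text \<open>The step raises \<open>k\<close> and keeps \<open>l\<close>; the parameter
  \<open>3 * m + 3 * n + 2\<close> is positive.\<close>

lemma upper_triangle_word_left:
  assumes "lower_triangle_word m n = w" "m + n \<ge> 0"
  shows "upper_triangle_word (m + 1) n = refl_word (rot (rot w))"
proof -
  note t1 = triple_rotate[OF lower_triangle[of m n]]
  note t2 = triple_rotate[OF t1]
  have "mirror (okamoto_Q m (n - 1)) (okamoto_Q (m + 1) (n - 1)) (okamoto_Q m n) (okamoto_Q (m + 1) n) (3 * m + 3 * n + 2)"
    using mirror_sym[OF okamoto_facts(3)[of "m + 1" n]] by (simp add: algebra_simps)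
  from word3_refl[OF t2 this] show ?thesis
    using assms word3_rot[OF lower_triangle[of m n]] word3_rot[OF t1] by simp
qed

text \<open>The seed triangle has no roots. From it the induction follows the edge
  \<open>k = 0\<close> of the sector and then the direction of \<open>k\<close>.\<close>

lemma upper_triangle_words: "upper_triangle_word (int k + int l) (- int l) = upper_word k l"
proof (induction k)
  case 0
  show ?case
  proof (induction l)
    case 0
    have "okamoto_Q 0 0 = 1" "okamoto_Q 0 (- 1) = 1" "okamoto_Q (- 1) 0 = 1"
      using okamoto_Q(2) by (simp_all add: okamoto_rec_def)
    moreover have "roots 1 = []" by (simp add: roots_def)
    ultimately show ?case by (simp add: word3_def upper_word_def)
  next
    case (Suc l)
    have "lower_triangle_word (int l) (- int l) = lower_word 0 l"
      using lower_triangle_word[OF Suc] by (simp add: refl_upper)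
    from upper_triangle_word_right[OF this]
    have "upper_triangle_word (int l + 1) (- int l - 1) = upper_word 0 (Suc l)"
      by (simp add: refl_lower_right)
    moreover have "- int (Suc l) = - int l - 1" "int 0 + int (Suc l) = int l + 1" by simp_all
    ultimately show ?case by (simp only:)
  qed
next
  case (Suc k)
  have "lower_triangle_word (int k + int l) (- int l) = lower_word k l"
    using lower_triangle_word[OF Suc] by (simp add: refl_upper)
  from upper_triangle_word_left[OF this]
  have "upper_triangle_word (int k + int l + 1) (- int l) = upper_word (Suc k) l"
    by (simp add: refl_lower_left)
  moreover have "int (Suc k) + int l = int k + int l + 1" by simp
  ultimately show ?case by (simp only:)
qed

lemma rhombus_words:
  fixes k l :: nat
  defines "m \<equiv> int k + int l" and "n \<equiv> - int l"
  shows "word4 (okamoto_Q m n) (okamoto_Q m (n - 1)) (okamoto_Q (m + 1) (n - 1)) (okamoto_Q (m + 1) (n - 2)) = rhombus_word k l"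
proof -
  have "lower_triangle_word m n = lower_word k l"
    using lower_triangle_word[OF upper_triangle_words] by (simp add: refl_upper m_def n_def)
  moreover have "2 - 3 * n > 0" by (simp add: n_def)
  ultimately show ?thesis
    using word4_fill[OF triple_rotate[OF lower_triangle[of m n]] mirror_lower_right]
      word3_rot[OF lower_triangle[of m n]] by (simp add: fill_rhombus)
qed

section \<open>Zeros and poles\<close>

text \<open>On a rhombus \<open>q = - root2 * x * s / (3 * y * z)\<close>: roots of \<open>y\<close>
  and \<open>z\<close> are poles with residue 1 and -1, and the zeros at roots of \<open>x\<close>
  and \<open>s\<close> are told apart by the sign in the Wronskian relation.\<close>

definition sing_of :: "nat \<Rightarrow> sing" where
  "sing_of i = [Zm, Pp, Pm, Zp] ! i"

lemma okamoto_q_eq: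
  fixes y z :: "real poly"
  assumes "poly y t \<noteq> 0" "poly z t \<noteq> 0"
  shows "- (2/3) * t + poly (pderiv y) t / poly y t - poly (pderiv z) t / poly z t
    = - poly (bilin z y) t / (3 * poly (z * y) t)"
  using assms by (simp add: bilin_def field_simps)

lemma simple_pole_lim:
  fixes p :: "real poly"
  assumes "poly p t = 0" "poly (pderiv p) t \<noteq> 0"
  shows "((\<lambda>u. (u - t) * (poly (pderiv p) u / poly p u)) \<longlongrightarrow> 1) (at t)"
proof -
  have "((\<lambda>u. (poly p u - poly p t) / (u - t)) \<longlongrightarrow> poly (pderiv p) t) (at t)"
    using poly_DERIV[of p t] by (simp add: has_field_derivative_iff)
  then have "((\<lambda>u. poly (pderiv p) u / ((poly p u - poly p t) / (u - t)))
      \<longlongrightarrow> poly (pderiv p) t / poly (pderiv p) t) (at t)"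
    using assms(2) by (intro tendsto_divide tendsto_poly tendsto_ident_at)
  then show ?thesis using assms by (simp add: mult.commute)
qed

lemma regular_log_lim:
  fixes p :: "real poly"
  assumes "poly p t \<noteq> 0"
  shows "((\<lambda>u. (u - t) * (poly (pderiv p) u / poly p u)) \<longlongrightarrow> 0) (at t)"
proof -
  have "((\<lambda>u. (u - t) * (poly (pderiv p) u / poly p u)) \<longlongrightarrow> (t - t) * (poly (pderiv p) t / poly p t)) (at t)"
    using assms by (intro tendsto_intros)
  then show ?thesis by simp
qed

lemma residue_pole:
  fixes q :: "real \<Rightarrow> real"
  assumes "((\<lambda>u. (u - t) * q u) \<longlongrightarrow> c) (at t)" "c \<noteq> 0"
  shows "is_pole q t" "\<not> is_zero q t"
proof -
  have "filterlim (\<lambda>u. u - t) (at 0) (at t)"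
    by (intro filterlim_atI tendsto_eq_intros) (auto simp: eventually_at_filter)
  then have "filterlim (\<lambda>u. ((u - t) * q u) / (u - t)) at_infinity (at t)"
    by (intro filterlim_divide_at_infinity[OF assms(1)] assms(2))
  moreover have "\<forall>\<^sub>F u in at t. ((u - t) * q u) / (u - t) = q u"
    by (auto simp: eventually_at_filter)
  ultimately have inf: "filterlim q at_infinity (at t)"
    using filterlim_cong[OF refl refl, of "\<lambda>u. ((u - t) * q u) / (u - t)" q "at t" at_infinity] by simp
  then show "is_pole q t"
    unfolding is_pole_def using filterlim_at_infinity_imp_norm_at_top[OF inf] by simp
  show "\<not> is_zero q t"
    using inf not_tendsto_and_filterlim_at_infinity[of "at t" q "q t"]
    by (auto simp: is_zero_def isCont_def)
qed

lemma isCont_not_pole: "isCont q t \<Longrightarrow> \<not> is_pole q (t :: real)"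
proof
  assume "isCont q t" "is_pole q t"
  then have "filterlim q at_infinity (at t)" "(q \<longlongrightarrow> q t) (at t)"
    by (auto simp: is_pole_def isCont_def intro: filterlim_norm_at_top_imp_at_infinity)
  then show False using not_tendsto_and_filterlim_at_infinity[of "at t" q "q t"] by simp
qed

text \<open>Reversing and negating reproduces the list, since an increasing list is determined by
  its set; so the middle entry is its own negative. This places the hatted letter at 0.\<close>

lemma symmetric_list_middle:
  fixes ts :: "real list"
  assumes s: "sorted_wrt (<) ts" and sym: "\<And>t. - t \<in> set ts \<longleftrightarrow> t \<in> set ts"
    and len: "length ts = 2 * p + 1"
  shows "ts ! p = 0"
proof -
  have "sorted_wrt (<) (map uminus (rev ts))"
    using s by (simp add: sorted_wrt_map sorted_wrt_rev)
  moreover have "set (map uminus (rev ts)) = set ts"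
    using sym by (auto simp: image_iff) (metis minus_minus)
  ultimately have "map uminus (rev ts) = ts"
    using s by (metis strict_sorted_iff sorted_distinct_set_unique)
  then have "ts ! p = map uminus (rev ts) ! p" by simp
  also have "\<dots> = - ts ! p" using len by (simp add: rev_nth)
  finally show ?thesis by simp
qed

lemma rhombus_signature:
  fixes n :: int
  assumes t: "triple x y z i j k" and m: "mirror x y z s a" and a: "a = - 1 - 3 * n" "a \<noteq> 0"
    and q: "q = (\<lambda>t. - (2/3) * t + poly (pderiv y) t / poly y t - poly (pderiv z) t / poly z t)"
    and sym: "\<And>t. poly (x * y * z * s) (- t) = 0 \<longleftrightarrow> poly (x * y * z * s) t = 0"
    and w: "map sing_of (word4 x y z s) = L @ c # R" and len: "length L = length R"
  shows "has_signature (1/3 + of_int n) q L c R"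
proof -
  define ts where "ts = roots (x * y * z * s)"
  have nz: "x \<noteq> 0" "y \<noteq> 0" "z \<noteq> 0" using triple_nonzero[OF t] .
  have s0: "s \<noteq> 0" using mirror_coprime[OF t m a(2)] by auto
  have ts: "sorted_wrt (<) ts" "set ts = {t. poly (x * y * z * s) t = 0}"
    unfolding ts_def using nz s0 by (intro roots_props; simp)+
  have F: "bilin z y = root2 * x * s" using m by (simp add: mirror_def)
  have hF: "poly (bilin z y) u = sqrt 2 * poly x u * poly s u" for u unfolding F by simp
  have q_eq: "q u = - poly (bilin z y) u / (3 * poly (z * y) u)" if "poly (z * y) u \<noteq> 0" for u
    using okamoto_q_eq[of y u z] that by (simp add: q)
  have der: "(q has_real_derivative
      - (poly (pderiv (bilin z y)) u * poly (z * y) u - poly (bilin z y) u * poly (pderiv (z * y)) u)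
        / (3 * (poly (z * y) u)^2)) (at u)" if u: "poly (z * y) u \<noteq> 0" for u
  proof -
    have 1: "((\<lambda>v. - poly (bilin z y) v / (3 * poly (z * y) v)) has_real_derivative
      - (poly (pderiv (bilin z y)) u * poly (z * y) u - poly (bilin z y) u * poly (pderiv (z * y)) u)
        / (3 * (poly (z * y) u)^2)) (at u)"
      using u by (auto intro!: derivative_eq_intros poly_DERIV simp del: poly_mult simp: field_simps power2_eq_square)
    have 2: "\<forall>\<^sub>F v in nhds u. q v = - poly (bilin z y) v / (3 * poly (z * y) v)"
    proof -
      have "\<forall>\<^sub>F v in nhds u. poly (z * y) v \<noteq> 0"
        by (rule tendsto_imp_eventually_ne[OF tendsto_poly[OF filterlim_ident] u])
      then show ?thesis by (rule eventually_mono) (rule q_eq)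
    qed
    show ?thesis using 1 by (simp only: DERIV_cong_ev[OF refl 2 refl])
  qed
  have res_y: "((\<lambda>u. (u - r) * q u) \<longlongrightarrow> 1) (at r)" if "poly y r = 0" for r
  proof -
    note tr = triple_roots(2)[OF t that]
    have "((\<lambda>u. (u - r) * (- (2/3) * u) + (u - r) * (poly (pderiv y) u / poly y u)
        - (u - r) * (poly (pderiv z) u / poly z u)) \<longlongrightarrow> (r - r) * (- (2/3) * r) + 1 - 0) (at r)"
      using tr that by (intro tendsto_add tendsto_diff simple_pole_lim regular_log_lim tendsto_intros) auto
    then show ?thesis by (simp add: q algebra_simps)
  qed
  have res_z: "((\<lambda>u. (u - r) * q u) \<longlongrightarrow> - 1) (at r)" if "poly z r = 0" for r
  proof -
    note tr = triple_roots(3)[OF t that]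
    have "((\<lambda>u. (u - r) * (- (2/3) * u) + (u - r) * (poly (pderiv y) u / poly y u)
        - (u - r) * (poly (pderiv z) u / poly z u)) \<longlongrightarrow> (r - r) * (- (2/3) * r) + 0 - 1) (at r)"
      using tr that by (intro tendsto_add tendsto_diff simple_pole_lim regular_log_lim tendsto_intros) auto
    then show ?thesis by (simp add: q algebra_simps)
  qed
  have type: "sing_type (1/3 + of_int n) q r (sing_of (letter x y z r))"
    and zp: "is_zero q r \<or> is_pole q r" if r: "poly (x * y * z * s) r = 0" for r
  proof -
    have zero: "sing_type (1/3 + of_int n) q r (sing_of (letter x y z r)) \<and> is_zero q r"
      if yz: "poly y r \<noteq> 0" "poly z r \<noteq> 0" and xs: "poly x r = 0 \<and> poly s r \<noteq> 0 \<or> poly s r = 0 \<and> poly x r \<noteq> 0"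
    proof -
      have zy: "poly (z * y) r \<noteq> 0" using yz by simp
      have h0: "poly (bilin z y) r = 0" unfolding hF using xs by auto
      have q0: "q r = 0" using q_eq[OF zy] h0 by simp
      define D where "D = - poly (pderiv (bilin z y)) r / (3 * poly (z * y) r)"
      have D: "(q has_real_derivative D) (at r)"
        using der[OF zy] h0 zy by (simp add: D_def power2_eq_square)
      then have z0: "is_zero q r" using q0 DERIV_isCont by (auto simp: is_zero_def)
      have "poly (pderiv (bilin z y)) r = sqrt 2 * (poly (pderiv x) r * poly s r + poly x r * poly (pderiv s) r)"
        unfolding F by (simp add: pderiv_mult pderiv_smult algebra_simps)
      \<comment> \<open>One of the two products in the derivative vanishes, and the other is the
        Wronskian up to sign.\<close>
      then have N: "poly (pderiv (bilin z y)) r = (if poly x r = 0 then - 1 else 1) * (2 * of_int a * poly y r * poly z r)"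
        using mirror_poly(2)[OF m, of r] xs by (auto simp: algebra_simps)
      have "D = - (if poly x r = 0 then - 1 else 1) * (2 * of_int a) / 3"
        unfolding D_def N using yz by (simp add: divide_simps)
      moreover have "of_int a = (- 1 - 3 * of_int n :: real)" by (simp add: a)
      \<comment> \<open>Since \<open>a = - 3 * (1/3 + n)\<close>, the slope is twice the parameter
        \<open>a\<^sub>1\<close>, up to the sign that separates \<open>Zp\<close> from
        \<open>Zm\<close>.\<close>
      ultimately have "D = (if poly x r = 0 then - (2 * (1/3 + of_int n)) else 2 * (1/3 + of_int n))"
        by (cases "poly x r = 0") simp_all
      then show ?thesis
        using z0 D q0 xs yz by (auto simp: sing_type_def sing_of_def letter_def)
    qed
    consider "poly x r = 0" | "poly y r = 0" | "poly z r = 0" | "poly s r = 0" using r by auto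
    then have "sing_type (1/3 + of_int n) q r (sing_of (letter x y z r)) \<and> (is_zero q r \<or> is_pole q r)"
    proof cases
      case 1
      moreover have "poly s r \<noteq> 0" using mirror_roots(1)[OF t m a(2), of r] 1 by blast
      ultimately show ?thesis using zero triple_roots(1)[OF t 1] by blast
    next
      case 2
      then have "letter x y z r = 1" using triple_roots(2)[OF t 2] by (simp add: letter_def)
      then show ?thesis using res_y[OF 2] residue_pole[OF res_y[OF 2]] by (simp add: sing_of_def sing_type_def)
    next
      case 3
      then have "letter x y z r = 2" using triple_roots(3)[OF t 3] by (simp add: letter_def)
      then show ?thesis using res_z[OF 3] residue_pole[OF res_z[OF 3]]
        by (simp add: sing_of_def sing_type_def)
    next
      case 4
      then show ?thesis using zero mirror_roots[OF t m a(2) 4] by blast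
    qed
    then show "sing_type (1/3 + of_int n) q r (sing_of (letter x y z r))" "is_zero q r \<or> is_pole q r"
      by simp_all
  qed
  \<comment> \<open>Where \<open>z * y\<close> is nonzero, \<open>q\<close> is continuous, so only a
    zero is possible, and \<open>bilin z y\<close> vanishes there.\<close>
  have conv: "poly (x * y * z * s) r = 0" if r: "is_zero q r \<or> is_pole q r" for r
  proof (cases "poly (z * y) r = 0")
    case False
    then have "is_zero q r" using r isCont_not_pole[OF DERIV_isCont[OF der[OF False]]] by blast
    then have "poly (bilin z y) r = 0" using q_eq[OF False] False by (auto simp: is_zero_def)
    then show ?thesis using hF[of r] by auto
  qed auto
  have word: "L @ c # R = map (\<lambda>r. sing_of (letter x y z r)) ts"
    using w by (simp add: word4_def ts_def o_def)
  then have l: "length ts = length (L @ c # R)" by (metis length_map)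
  show ?thesis
    unfolding has_signature_def
  proof (intro exI[of _ ts] conjI)
    show "sorted_wrt (<) ts" by (rule ts)
    show "set ts = {t. is_zero q t \<or> is_pole q t}" using ts(2) zp conv by blast
    show "length ts = length (L @ c # R)" by (rule l)
    show "\<forall>i<length ts. sing_type (1/3 + of_int n) q (ts ! i) ((L @ c # R) ! i)"
      unfolding word using type ts(2) by (auto simp del: poly_mult dest: nth_mem)
    show "ts ! length L = 0"
      using symmetric_list_middle[OF ts(1), of "length L"] sym l len by (simp add: ts(2) del: poly_mult)
  qed
qed

lemma okamoto_signature:
  fixes k l :: nat
  assumes "m + n = int k" "n = - 1 - int l"
    and w: "map sing_of (rhombus_word k l) = L @ c # R" and len: "length L = length R"
  shows "has_signature (1/3 + of_int n) (okamoto_q m n) L c R"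
proof -
  \<comment> \<open>The edge of \<open>q\<close> at \<open>(m, n)\<close> lies in the rhombus with
    base point \<open>(m - 1, n + 1)\<close>; hence \<open>l = - n - 1\<close>.\<close>
  have mn: "m = int k + int l + 1" "n = - int l - 1" using assms by simp_all
  note t = triple_rotate[OF lower_triangle[of "int k + int l" "- int l"]]
  note mi = mirror_lower_right[of "int k + int l" "- int l"]
  show ?thesis
  proof (rule rhombus_signature[OF t mi])
    show "2 - 3 * (- int l) = - 1 - 3 * n" by (simp add: mn)
    show "2 - 3 * (- int l) \<noteq> 0" by simp
    show "map sing_of (word4 (okamoto_Q (int k + int l) (- int l)) (okamoto_Q (int k + int l) (- int l - 1))
        (okamoto_Q (int k + int l + 1) (- int l - 1)) (okamoto_Q (int k + int l + 1) (- int l - 2))) = L @ c # R"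
      unfolding rhombus_words by (rule w)
  qed (auto simp: okamoto_q_def mn okamoto_root_neg len)
qed

lemma map_sing_rhombus_word:
  "map sing_of (rhombus_word (2 * \<mu>) l) =
     pw \<mu> [Pm, Zm, Zp, Pp] @ Pm # pw l [Zm, Pm] @ pw \<mu> [Pp, Zp, Zm, Pm]"
  "map sing_of (rhombus_word (2 * \<mu> + 1) l) =
     pw \<mu> [Pm, Zm, Zp, Pp] @ [Pm, Zm] @ pw l [Zp, Pp] @ [Zp, Pp, Zp, Zm, Pm] @ pw \<mu> [Pp, Zp, Zm, Pm]"
  by (simp_all add: rhombus_word_def sing_of_def repeat_word_def[symmetric] pw_def)

lemma pw_rep: "pw k w = repeat_word k w"
  by (simp add: pw_def repeat_word_def)

theorem mainTheorem6:
  fixes m n :: int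
  assumes "m + n \<ge> 1" and "n \<le> -1"
  shows
   "(\<forall>\<mu> \<nu> :: nat. m = 2 * int \<mu> + 2 * int \<nu> \<and> n = - 2 * int \<nu> \<longrightarrow>
       has_signature (1/3 + of_int n) (okamoto_q m n)
         (pw \<mu> [Pm, Zm, Zp, Pp] @ pw (\<nu> - 1) [Pm, Zm] @ [Pm])
         Zm
         ([Pm] @ pw (\<nu> - 1) [Zm, Pm] @ pw \<mu> [Pp, Zp, Zm, Pm])) \<and>
    (\<forall>\<mu> \<nu> :: nat. m = 2 + 2 * int \<mu> + 2 * int \<nu> \<and> n = - 1 - 2 * int \<nu> \<longrightarrow>
       has_signature (1/3 + of_int n) (okamoto_q m n)
         (pw \<mu> [Pm, Zm, Zp, Pp] @ [Pm, Zm] @ pw \<nu> [Zp, Pp] @ [Zp])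
         Pp
         ([Zp] @ pw \<nu> [Pp, Zp] @ [Zm, Pm] @ pw \<mu> [Pp, Zp, Zm, Pm])) \<and>
    (\<forall>\<mu> \<nu> :: nat. m = 1 + 2 * int \<mu> + 2 * int \<nu> \<and> n = - 2 * int \<nu> \<longrightarrow>
       has_signature (1/3 + of_int n) (okamoto_q m n)
         (pw (\<mu> + 1) [Pm, Zm, Zp, Pp] @ pw (\<nu> - 1) [Zp, Pp])
         Zp
         (pw (\<nu> - 1) [Pp, Zp] @ pw (\<mu> + 1) [Pp, Zp, Zm, Pm])) \<and>
    (\<forall>\<mu> \<nu> :: nat. m = 1 + 2 * int \<mu> + 2 * int \<nu> \<and> n = - 1 - 2 * int \<nu> \<longrightarrow>
       has_signature (1/3 + of_int n) (okamoto_q m n)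
         (pw \<mu> [Pm, Zm, Zp, Pp] @ pw \<nu> [Pm, Zm])
         Pm
         (pw \<nu> [Zm, Pm] @ pw \<mu> [Pp, Zp, Zm, Pm]))"
proof (intro conjI allI impI)
  fix \<mu> \<nu> :: nat assume mn: "m = 2 * int \<mu> + 2 * int \<nu> \<and> n = - 2 * int \<nu>"
  then obtain p where p: "\<nu> = Suc p" using assms by (cases \<nu>) auto
  \<comment> \<open>Here \<open>k = m + n = 2 * \<mu>\<close> and
    \<open>l = - n - 1 = 2 * p + 1\<close>; the split isolates the block with the letter at
    0.\<close>
  have "2 * p + 1 = p + (1 + p)" by simp
  then show "has_signature (1/3 + of_int n) (okamoto_q m n)
         (pw \<mu> [Pm, Zm, Zp, Pp] @ pw (\<nu> - 1) [Pm, Zm] @ [Pm]) Zm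
         ([Pm] @ pw (\<nu> - 1) [Zm, Pm] @ pw \<mu> [Pp, Zp, Zm, Pm])"
    using mn by (intro okamoto_signature[where k = "2 * \<mu>" and l = "2 * p + 1"])
      (simp_all only: p map_sing_rhombus_word, simp_all add: pw_rep rep_add rep_shifts)
next
  fix \<mu> \<nu> :: nat assume mn: "m = 2 + 2 * int \<mu> + 2 * int \<nu> \<and> n = - 1 - 2 * int \<nu>"
  \<comment> \<open>Now \<open>k\<close> is odd and \<open>l = 2 * \<nu>\<close>; conjugating the
    second half brings \<open>Pp\<close> to the middle.\<close>
  have "2 * \<nu> = \<nu> + \<nu>" by simp
  then show "has_signature (1/3 + of_int n) (okamoto_q m n)
         (pw \<mu> [Pm, Zm, Zp, Pp] @ [Pm, Zm] @ pw \<nu> [Zp, Pp] @ [Zp]) Pp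
         ([Zp] @ pw \<nu> [Pp, Zp] @ [Zm, Pm] @ pw \<mu> [Pp, Zp, Zm, Pm])"
    using mn by (intro okamoto_signature[where k = "2 * \<mu> + 1" and l = "2 * \<nu>"])
      (simp_all only: map_sing_rhombus_word, simp_all add: pw_rep rep_add rep_shifts)
next
  fix \<mu> \<nu> :: nat assume mn: "m = 1 + 2 * int \<mu> + 2 * int \<nu> \<and> n = - 2 * int \<nu>"
  then obtain p where p: "\<nu> = Suc p" using assms by (cases \<nu>) auto
  \<comment> \<open>The letters \<open>Pm, Zm\<close> and the first \<open>Zp, Pp\<close> form one
    more block of four, and likewise on the right; hence the exponent
    \<open>\<mu> + 1\<close>.\<close>
  have "2 * p + 1 = p + (1 + p)" by simp
  then show "has_signature (1/3 + of_int n) (okamoto_q m n)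
         (pw (\<mu> + 1) [Pm, Zm, Zp, Pp] @ pw (\<nu> - 1) [Zp, Pp]) Zp
         (pw (\<nu> - 1) [Pp, Zp] @ pw (\<mu> + 1) [Pp, Zp, Zm, Pm])"
    using mn by (intro okamoto_signature[where k = "2 * \<mu> + 1" and l = "2 * p + 1"])
      (simp_all only: p map_sing_rhombus_word, simp_all add: pw_rep rep_add rep_shifts)
next
  fix \<mu> \<nu> :: nat assume mn: "m = 1 + 2 * int \<mu> + 2 * int \<nu> \<and> n = - 1 - 2 * int \<nu>"
  have "2 * \<nu> = \<nu> + \<nu>" by simp
  then show "has_signature (1/3 + of_int n) (okamoto_q m n)
         (pw \<mu> [Pm, Zm, Zp, Pp] @ pw \<nu> [Pm, Zm]) Pm
         (pw \<nu> [Zm, Pm] @ pw \<mu> [Pp, Zp, Zm, Pm])"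
    using mn by (intro okamoto_signature[where k = "2 * \<mu>" and l = "2 * \<nu>"])
      (simp_all only: map_sing_rhombus_word, simp_all add: pw_rep rep_add rep_shifts)
qed

end
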